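(* Let $S$ be a left cancellative semigroup such that $I_l(S)$ is $E^*$-unitary. Then the canonical surjective $*$-homomorphism $h:C^*_{r,0}(I_l(S))\to C^*_r(S)$, determined by $h(\Lambda_0(f))=\omega(f)$ for all $f\in I_l(S)$, is an isomorphism if and only if $J(S)$ is independent.
   Context: A semigroup means a set with associative product and identity element $1$. $S$ is left cancellative if $sr=st$ implies $r=t$. For $s\in S$ let $\lambda_s:S\to sS$, $\lambda_s(t)=st$. $I(S)$ is the inverse semigroup of all partially defined bijections of $S$ (product $fg$ is composition on $g^{-1}(\mathrm{dom} f)$; $f^*$ is the inverse map; the empty map is the zero $0$). $I_l(S)$ is the inverse subsemigroup of $I(S)$ generated by $\{\lambda_s\}_{s\in S}$. $I_l(S)$ is $E^*$-unitary if for all $p,q\in I_l(S)$, $pq=q$ and $q\ne 0$ imply that $p$ is idempotent. $J(S)$ is the set of all finite intersections of subsets of $S$ of the form $t_1^{-1}s_1\cdots t_n^{-1}s_nS$ ($n\ge1$, $s_i,t_i\in S$), where $sX=\{sx:x\in X\}$ and $t^{-1}X=\{r\in S:tr\in X\}$. It is independent if whenever $X_1,\dots,X_n,Y\in J(S)$ ($n\ge1$) satisfy $\bigcup_i X_i=Y$, then $X_i=Y$ for at least one $i$. $\{\varepsilon_s\}$ is the canonical orthonormal basis of $\ell^2(S)$, $V_s\varepsilon_t=\varepsilon_{st}$, and $C^*_r(S)\subset B(\ell^2(S))$ is the $C^*$-algebra generated by $\{V_s:s\in S\}$. For $f\in I_l(S)$, $\omega(f)\varepsilon_s=\varepsilon_{f(s)}$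 if $s\in\mathrm{dom}(f)$ and $0$ otherwise. For an inverse semigroup $P$, with canonical basis $\{\delta_q\}_{q\in P}$ of $\ell^2(P)$, $\Lambda(p)\delta_q=\delta_{pq}$ if $p^*pq=q$ and $0$ otherwise; $C^*_r(P)$ is the closed linear span of $\Lambda(P)$ in $B(\ell^2(P))$. If $P=I_l(S)$ contains the empty map $0$, $C^*_{r,0}(P)=C^*_r(P)/\mathbb{C}\Lambda(0)$; otherwise $C^*_{r,0}(P)=C^*_r(P)$. $\Lambda_0(p)$ is the image of $\Lambda(p)$ in $C^*_{r,0}(P)$. The $*$-homomorphism $h$ with the stated property exists and is unique. *)

theory Defs
  imports "HOL-Analysis.Analysis" "HOL-Algebra.QuotRing" "HOL-Algebra.Module"
begin

section \<open>The Hilbert space of square summable families on an arbitrary index type\<close>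

definition square_summable :: "('x \<Rightarrow> complex) \<Rightarrow> bool" where
  "square_summable f \<longleftrightarrow> (\<lambda>x. (cmod (f x))\<^sup>2) summable_on UNIV"

lemma square_summable_zero: "square_summable (\<lambda>_. 0)"
  by (simp add: square_summable_def)

lemma square_summable_cmult: "square_summable f \<Longrightarrow> square_summable (\<lambda>x. c * f x)"
  unfolding square_summable_def norm_mult power_mult_distrib
  by (rule summable_on_cmult_right)

lemma square_summable_add:
  assumes "square_summable f" "square_summable g"
  shows "square_summable (\<lambda>x. f x + g x)"
proof -
  have "(\<lambda>x. 2 * (cmod (f x))\<^sup>2 + 2 * (cmod (g x))\<^sup>2) summable_on UNIV"
    using assms unfolding square_summable_def
    by (intro summable_on_add summable_on_cmult_right)
  moreover have "(cmod (f x + g x))\<^sup>2 \<le> 2 * (cmod (f x))\<^sup>2 + 2 * (cmod (g x))\<^sup>2" for x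
  proof -
    have "(cmod (f x + g x))\<^sup>2 \<le> (cmod (f x) + cmod (g x))\<^sup>2"
      by (intro power_mono norm_triangle_ineq) simp
    also have "\<dots> \<le> 2 * (cmod (f x))\<^sup>2 + 2 * (cmod (g x))\<^sup>2"
      using sum_squares_bound[of "cmod (f x)" "cmod (g x)"] by (simp add: power2_sum)
    finally show ?thesis .
  qed
  ultimately show ?thesis
    unfolding square_summable_def by (rule summable_on_comparison_test) auto
qed

lemma square_summable_prod:
  assumes "square_summable f" "square_summable g"
  shows "(\<lambda>x. f x * cnj (g x)) summable_on UNIV"
proof -
  have "(\<lambda>x. (cmod (f x))\<^sup>2 + (cmod (g x))\<^sup>2) summable_on UNIV"
    using assms unfolding square_summable_def by (rule summable_on_add)
  moreover have "cmod (f x * cnj (g x)) \<le> (cmod (f x))\<^sup>2 + (cmod (g x))\<^sup>2" for x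
    using sum_squares_bound[of "cmod (f x)" "cmod (g x)"]
      mult_nonneg_nonneg[of "cmod (f x)" "cmod (g x)"]
    unfolding norm_mult complex_mod_cnj mult.assoc by (smt (verit) norm_ge_zero)
  ultimately have "(\<lambda>x. cmod (f x * cnj (g x))) summable_on UNIV"
    by (rule summable_on_comparison_test) auto
  then show ?thesis
    by (simp add: summable_on_iff_abs_summable_on_complex)
qed

typedef 'x ell2 = "{f :: 'x \<Rightarrow> complex. square_summable f}"
  morphisms coeff Abs_ell2
  using square_summable_zero by auto

setup_lifting type_definition_ell2

lemma square_summable_coeff: "square_summable (coeff \<xi>)"
  using coeff by blast

lift_definition cscale :: "complex \<Rightarrow> 'x ell2 \<Rightarrow> 'x ell2" (infixr \<open>*\<^sub>C\<close> 75)
  is "\<lambda>c f x. c * f x" by (rule square_summable_cmult)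

definition cinner :: "'x ell2 \<Rightarrow> 'x ell2 \<Rightarrow> complex" where
  "cinner \<xi> \<eta> = (\<Sum>\<^sub>\<infinity>x. coeff \<xi> x * cnj (coeff \<eta> x))"

lift_definition ket :: "'x \<Rightarrow> 'x ell2" is "\<lambda>x y. if y = x then 1 else 0"
proof -
  fix x :: 'x
  have "(\<lambda>y. (cmod (if y = x then 1 else 0))\<^sup>2) summable_on {x}"
    by simp
  then show "square_summable (\<lambda>y. if y = x then 1 else (0::complex))"
    unfolding square_summable_def
    by (rule summable_on_cong_neutral[THEN iffD1, rotated -1]) auto
qed

instantiation ell2 :: (type) real_vector
begin

lift_definition zero_ell2 :: "'a ell2" is "\<lambda>_. 0" by (rule square_summable_zero)
lift_definition plus_ell2 :: "'a ell2 \<Rightarrow> 'a ell2 \<Rightarrow> 'a ell2" is "\<lambda>f g x. f x + g x"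
  by (rule square_summable_add)
lift_definition uminus_ell2 :: "'a ell2 \<Rightarrow> 'a ell2" is "\<lambda>f x. - f x"
  using square_summable_cmult[of _ "-1"] by simp
lift_definition minus_ell2 :: "'a ell2 \<Rightarrow> 'a ell2 \<Rightarrow> 'a ell2" is "\<lambda>f g x. f x - g x"
  using square_summable_add[OF _ square_summable_cmult[of _ "-1"]] by simp
lift_definition scaleR_ell2 :: "real \<Rightarrow> 'a ell2 \<Rightarrow> 'a ell2" is "\<lambda>r f x. complex_of_real r * f x"
  by (rule square_summable_cmult)

instance
  by standard (transfer; simp add: algebra_simps)+

end

lemma cinner_summable: "(\<lambda>x. coeff \<xi> x * cnj (coeff \<eta> x)) summable_on UNIV"
  by (intro square_summable_prod square_summable_coeff)

lemma cinner_add_left: "cinner (\<xi> + \<xi>') \<eta> = cinner \<xi> \<eta> + cinner \<xi>' \<eta>"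
  unfolding cinner_def plus_ell2.rep_eq
  by (simp add: distrib_right infsum_add cinner_summable)

lemma cinner_scale_left: "cinner (c *\<^sub>C \<xi>) \<eta> = c * cinner \<xi> \<eta>"
  unfolding cinner_def cscale.rep_eq
  by (simp add: mult.assoc infsum_cmult_right cinner_summable)

lemma cinner_commute: "cinner \<xi> \<eta> = cnj (cinner \<eta> \<xi>)"
  unfolding cinner_def by (simp flip: infsum_cnj add: mult.commute)

lemma scaleR_cscale: "r *\<^sub>R \<xi> = complex_of_real r *\<^sub>C \<xi>" for \<xi> :: "'x ell2"
  by transfer simp

lemma cinner_self: "cinner \<xi> \<xi> = complex_of_real (\<Sum>\<^sub>\<infinity>x. (cmod (coeff \<xi> x))\<^sup>2)"
proof -
  have "cinner \<xi> \<xi> = (\<Sum>\<^sub>\<infinity>x. complex_of_real ((cmod (coeff \<xi> x))\<^sup>2))"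
    unfolding cinner_def by (simp only: complex_norm_square)
  also have "\<dots> = complex_of_real (\<Sum>\<^sub>\<infinity>x. (cmod (coeff \<xi> x))\<^sup>2)"
    using square_summable_coeff[of \<xi>] unfolding square_summable_def
    by (intro infsumI has_sum_of_real has_sum_infsum)
  finally show ?thesis .
qed

lemma cinner_self_eq_0_iff: "cinner \<xi> \<xi> = 0 \<longleftrightarrow> \<xi> = 0"
proof
  assume "cinner \<xi> \<xi> = 0"
  then have *: "(\<Sum>\<^sub>\<infinity>x. (cmod (coeff \<xi> x))\<^sup>2) \<le> 0"
    by (simp add: cinner_self)
  have "(cmod (coeff \<xi> x))\<^sup>2 = 0" for x
    using nonneg_infsum_le_0D[OF *] square_summable_coeff[of \<xi>]
    unfolding square_summable_def by simp
  then show "\<xi> = 0"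
    by (simp add: coeff_inject[symmetric] zero_ell2.rep_eq fun_eq_iff)
qed (simp add: cinner_def zero_ell2.rep_eq)

instantiation ell2 :: (type) real_inner
begin

definition inner_ell2 :: "'a ell2 \<Rightarrow> 'a ell2 \<Rightarrow> real" where
  "inner_ell2 \<xi> \<eta> = Re (cinner \<xi> \<eta>)"
definition norm_ell2 :: "'a ell2 \<Rightarrow> real" where
  "norm_ell2 \<xi> = sqrt (inner \<xi> \<xi>)"
definition dist_ell2 :: "'a ell2 \<Rightarrow> 'a ell2 \<Rightarrow> real" where
  "dist_ell2 \<xi> \<eta> = norm (\<xi> - \<eta>)"
definition sgn_ell2 :: "'a ell2 \<Rightarrow> 'a ell2" where
  "sgn_ell2 \<xi> = inverse (norm \<xi>) *\<^sub>R \<xi>"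
definition uniformity_ell2 :: "('a ell2 \<times> 'a ell2) filter" where
  "uniformity_ell2 = (INF e\<in>{0<..}. principal {(x, y). dist x y < e})"
definition open_ell2 :: "'a ell2 set \<Rightarrow> bool" where
  "open_ell2 U \<longleftrightarrow> (\<forall>x\<in>U. eventually (\<lambda>(x', y). x' = x \<longrightarrow> y \<in> U) uniformity)"

instance
proof
  fix x y z :: "'a ell2" and r :: real
  show "dist x y = norm (x - y)" by (fact dist_ell2_def)
  show "sgn x = inverse (norm x) *\<^sub>R x" by (fact sgn_ell2_def)
  show "uniformity = (INF e\<in>{0<..}. principal {(x, y :: 'a ell2). dist x y < e})"
    by (fact uniformity_ell2_def)
  show "open U \<longleftrightarrow> (\<forall>x\<in>U. eventually (\<lambda>(x', y). x' = x \<longrightarrow> y \<in> U) uniformity)"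
    for U :: "'a ell2 set" by (fact open_ell2_def)
  show "inner x y = inner y x"
    unfolding inner_ell2_def by (subst cinner_commute) simp
  show "inner (x + y) z = inner x z + inner y z"
    by (simp add: inner_ell2_def cinner_add_left)
  show "inner (r *\<^sub>R x) y = r * inner x y"
    by (simp add: inner_ell2_def scaleR_cscale cinner_scale_left)
  show "0 \<le> inner x x"
    by (simp add: inner_ell2_def cinner_self infsum_nonneg)
  show "inner x x = 0 \<longleftrightarrow> x = 0"
    unfolding cinner_self_eq_0_iff[symmetric] by (simp add: inner_ell2_def cinner_self)
  show "norm x = sqrt (inner x x)" by (fact norm_ell2_def)
qed

end

lemma norm_ell2_square: "(norm \<xi>)\<^sup>2 = (\<Sum>\<^sub>\<infinity>x. (cmod (coeff \<xi> x))\<^sup>2)"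
  by (simp add: norm_ell2_def inner_ell2_def cinner_self infsum_nonneg)

lemma norm_cscale: "norm (c *\<^sub>C \<xi>) = cmod c * norm \<xi>"
proof -
  have "(norm (c *\<^sub>C \<xi>))\<^sup>2 = (cmod c * norm \<xi>)\<^sup>2"
    using square_summable_coeff[of \<xi>]
    by (simp add: power_mult_distrib norm_ell2_square cscale.rep_eq norm_mult
        infsum_cmult_right square_summable_def)
  then show ?thesis by (simp add: power2_eq_iff_nonneg)
qed


section \<open>Bounded complex linear operators\<close>

text \<open>
  The library type of bounded operators between real normed spaces carries the operator norm;
  \<open>bounded_ops\<close> consists of those operators that are complex linear, i.e. it is the
  C*-algebra of bounded operators on the Hilbert space.
\<close>

type_synonym 'x op = "'x ell2 \<Rightarrow>\<^sub>L 'x ell2"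

definition bounded_ops :: "'x op set" where
  "bounded_ops = {T :: 'x op. \<forall>c \<xi>. T (c *\<^sub>C \<xi>) = c *\<^sub>C T \<xi>}"

lemma bounded_linear_cscale: "bounded_linear (\<lambda>\<xi> :: 'x ell2. c *\<^sub>C \<xi>)"
proof (rule bounded_linear_intro[where K = "cmod c"])
  show "c *\<^sub>C (\<xi> + \<eta>) = c *\<^sub>C \<xi> + c *\<^sub>C \<eta>" for \<xi> \<eta> :: "'x ell2"
    by transfer (simp add: algebra_simps)
  show "c *\<^sub>C (r *\<^sub>R \<xi>) = r *\<^sub>R (c *\<^sub>C \<xi>)" for r and \<xi> :: "'x ell2"
    by transfer (simp add: algebra_simps)
  show "norm (c *\<^sub>C \<xi>) \<le> norm \<xi> * cmod c" for \<xi> :: "'x ell2"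
    by (simp add: norm_cscale)
qed

definition op_scale :: "complex \<Rightarrow> 'x op \<Rightarrow> 'x op" where
  "op_scale c T = Blinfun (\<lambda>\<xi>. c *\<^sub>C T \<xi>)"

lemma op_scale_apply: "op_scale c T \<xi> = c *\<^sub>C T \<xi>"
  unfolding op_scale_def
  by (simp add: bounded_linear_Blinfun_apply bounded_linear_compose[OF bounded_linear_cscale]
      blinfun.bounded_linear_right)

global_interpretation complex_op: vector_space "op_scale :: complex \<Rightarrow> 'x op \<Rightarrow> 'x op"
proof
  fix a b :: complex and S T :: "'x op"
  show "op_scale a (S + T) = op_scale a S + op_scale a T"
    by (rule blinfun_eqI, simp add: op_scale_apply blinfun.add_left, transfer, simp add: algebra_simps)
  show "op_scale (a + b) T = op_scale a T + op_scale b T"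
    by (rule blinfun_eqI, simp add: op_scale_apply blinfun.add_left, transfer, simp add: algebra_simps)
  show "op_scale a (op_scale b T) = op_scale (a * b) T"
    by (rule blinfun_eqI, simp add: op_scale_apply, transfer, simp add: algebra_simps)
  show "op_scale 1 T = T"
    by (rule blinfun_eqI, simp add: op_scale_apply, transfer, simp)
qed

definition adj :: "'x op \<Rightarrow> 'x op" where
  "adj T = (THE T'. T' \<in> bounded_ops \<and> (\<forall>\<xi> \<eta>. cinner (T \<xi>) \<eta> = cinner \<xi> (T' \<eta>)))"

definition cstar_subalgebra :: "'x op set \<Rightarrow> bool" where
  "cstar_subalgebra A \<longleftrightarrow>
     A \<subseteq> bounded_ops \<and> closed A \<and> 0 \<in> A \<and>
     (\<forall>S\<in>A. \<forall>T\<in>A. S + T \<in> A) \<and> (\<forall>c. \<forall>T\<in>A. op_scale c T \<in> A) \<and>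
     (\<forall>S\<in>A. \<forall>T\<in>A. S o\<^sub>L T \<in> A) \<and> (\<forall>T\<in>A. adj T \<in> A)"

definition cstar_generated :: "'x op set \<Rightarrow> 'x op set" where
  "cstar_generated G = \<Inter>{A. cstar_subalgebra A \<and> G \<subseteq> A}"

text \<open>
  For a partially defined injection \<open>f\<close>, the operator with \<open>ket x \<mapsto> ket (f x)\<close> on the domain of
  \<open>f\<close> and \<open>ket x \<mapsto> 0\<close> elsewhere; see \<open>basis_op_ket\<close> below for existence and uniqueness.
\<close>

definition basis_op :: "('x \<Rightarrow> 'x option) \<Rightarrow> 'x op" where
  "basis_op f = (THE T. T \<in> bounded_ops \<and>
     (\<forall>x. T (ket x) = (case f x of Some y \<Rightarrow> ket y | None \<Rightarrow> 0)))"

lemma coeff_sum: "coeff (\<Sum>i\<in>F. \<xi> i) x = (\<Sum>i\<in>F. coeff (\<xi> i) x)"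
  by (induction F rule: infinite_finite_induct) (simp_all add: zero_ell2.rep_eq plus_ell2.rep_eq)

lemma ket_approx:
  assumes "e > 0"
  obtains F where "finite F" "norm (\<xi> - (\<Sum>x\<in>F. coeff \<xi> x *\<^sub>C ket x)) < e"
proof -
  let ?g = "\<lambda>x. (cmod (coeff \<xi> x))\<^sup>2"
  have summ: "?g summable_on A" for A
    using square_summable_coeff[of \<xi>] summable_on_subset_banach
    unfolding square_summable_def by blast
  have "e\<^sup>2 > 0" using assms by simp
  then have "infsum ?g UNIV - e\<^sup>2 < infsum ?g UNIV" by simp
  moreover have "(?g has_sum infsum ?g UNIV) UNIV" using summ by simp
  then have "(sum ?g \<longlongrightarrow> infsum ?g UNIV) (finite_subsets_at_top UNIV)"
    by (simp add: has_sum_def)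
  ultimately have "eventually (\<lambda>F. sum ?g F > infsum ?g UNIV - e\<^sup>2) (finite_subsets_at_top UNIV)"
    using order_tendstoD(1) by blast
  then obtain F where F: "finite F" "sum ?g F > infsum ?g UNIV - e\<^sup>2"
    unfolding eventually_finite_subsets_at_top by auto
  let ?\<eta> = "\<xi> - (\<Sum>x\<in>F. coeff \<xi> x *\<^sub>C ket x)"
  have c: "coeff ?\<eta> y = (if y \<in> F then 0 else coeff \<xi> y)" for y
  proof -
    have "(\<Sum>x\<in>F. coeff \<xi> x * (if y = x then 1 else 0)) = (if y \<in> F then coeff \<xi> y else 0)"
      using F(1) by (simp add: if_distrib sum.delta' cong: if_cong)
    then show ?thesis
      by (simp add: minus_ell2.rep_eq coeff_sum cscale.rep_eq ket.rep_eq)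
  qed
  have "(norm ?\<eta>)\<^sup>2 = infsum ?g (- F)"
    unfolding norm_ell2_square by (rule infsum_cong_neutral) (auto simp: c)
  also have "\<dots> = infsum ?g UNIV - sum ?g F"
    using infsum_Diff[of ?g UNIV F] summ F(1) by (simp add: Compl_eq_Diff_UNIV)
  also have "\<dots> < e\<^sup>2" using F(2) by simp
  finally have "norm ?\<eta> < e" using assms by (simp add: power2_less_imp_less)
  with F(1) that show ?thesis by blast
qed

lemma bounded_ops_eqI:
  assumes "S \<in> bounded_ops" "T \<in> bounded_ops" and eq: "\<And>x. S (ket x) = T (ket x)"
  shows "S = T"
proof (rule blinfun_eqI)
  fix \<xi>
  let ?D = "S - T"
  have "norm (?D \<xi>) \<le> 0 + e" if "e > 0" for e
  proof -
    define K where "K = norm ?D + 1"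
    have K: "K > 0" "norm ?D \<le> K" unfolding K_def by (simp_all add: add_nonneg_pos)
    obtain F where F: "finite F" "norm (\<xi> - (\<Sum>x\<in>F. coeff \<xi> x *\<^sub>C ket x)) < e / K"
      using ket_approx[OF divide_pos_pos[OF \<open>e > 0\<close> K(1)]] by metis
    define \<eta> where "\<eta> = (\<Sum>x\<in>F. coeff \<xi> x *\<^sub>C ket x)"
    have "S (c *\<^sub>C ket x) = T (c *\<^sub>C ket x)" for c x
      using assms(1,2) eq[of x] unfolding bounded_ops_def by simp
    then have "S \<eta> = T \<eta>"
      unfolding \<eta>_def blinfun.sum_right by (intro sum.cong) auto
    then have "?D \<xi> = ?D (\<xi> - \<eta>)"
      by (simp add: blinfun.diff_left blinfun.diff_right)
    then have "norm (?D \<xi>) \<le> norm ?D * norm (\<xi> - \<eta>)"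
      using norm_blinfun[of ?D "\<xi> - \<eta>"] by metis
    also have "\<dots> \<le> K * (e / K)"
      using F(2) K unfolding \<eta>_def by (intro mult_mono) auto
    also have "\<dots> = 0 + e"
      using K(1) by simp
    finally show ?thesis .
  qed
  then have "norm (?D \<xi>) \<le> 0"
    by (rule field_le_epsilon)
  then show "S \<xi> = T \<xi>" by (simp add: blinfun.diff_left)
qed

lemma basis_op_exists:
  fixes f :: "'x \<Rightarrow> 'x option"
  assumes inj: "inj_on f (dom f)"
  obtains T where "T \<in> bounded_ops"
    "\<And>x. T (ket x) = (case f x of Some y \<Rightarrow> ket y | None \<Rightarrow> 0)"
proof -
  define g where "g y = (THE x. f x = Some y)" for y
  have g: "g y = x" if "f x = Some y" for x y
    unfolding g_def
  proof (rule the_equality)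
    show "f x = Some y" by (fact that)
    show "x' = x" if "f x' = Some y" for x'
      using inj_onD[OF inj, of x' x] that \<open>f x = Some y\<close> by auto
  qed
  define t where "t h y = (if y \<in> ran f then h (g y) else 0)" for h :: "'x \<Rightarrow> complex" and y
  have bij: "bij_betw g (ran f) (dom f)"
  proof (rule bij_betwI[where g = "\<lambda>x. the (f x)"])
    show "g \<in> ran f \<rightarrow> dom f" "(\<lambda>x. the (f x)) \<in> dom f \<rightarrow> ran f"
      by (auto simp: ran_def dom_def g)
    show "the (f (g y)) = y" if "y \<in> ran f" for y using that by (auto simp: ran_def g)
    show "g (the (f x)) = x" if "x \<in> dom f" for x using that by (auto simp: g)
  qed
  have summ: "(\<lambda>x. (cmod (h x))\<^sup>2) summable_on dom f" if "square_summable h" for h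
    using that summable_on_subset_banach unfolding square_summable_def by blast
  have tsumm: "square_summable (t h)" if "square_summable h" for h
  proof -
    have "(\<lambda>y. (cmod (h (g y)))\<^sup>2) summable_on ran f"
      using summable_on_reindex_bij_betw[OF bij, of "\<lambda>x. (cmod (h x))\<^sup>2"] summ[OF that] by simp
    then show ?thesis
      unfolding square_summable_def
      by (rule summable_on_cong_neutral[THEN iffD1, rotated -1]) (auto simp: t_def)
  qed
  have tnorm: "(\<Sum>\<^sub>\<infinity>y. (cmod (t h y))\<^sup>2) \<le> (\<Sum>\<^sub>\<infinity>x. (cmod (h x))\<^sup>2)" if "square_summable h" for h
  proof -
    have "(\<Sum>\<^sub>\<infinity>y. (cmod (t h y))\<^sup>2) = (\<Sum>\<^sub>\<infinity>y\<in>ran f. (cmod (h (g y)))\<^sup>2)"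
      by (rule infsum_cong_neutral) (auto simp: t_def)
    also have "\<dots> = (\<Sum>\<^sub>\<infinity>x\<in>dom f. (cmod (h x))\<^sup>2)"
      by (rule infsum_reindex_bij_betw[OF bij])
    also have "\<dots> \<le> (\<Sum>\<^sub>\<infinity>x. (cmod (h x))\<^sup>2)"
      using that summ[OF that] unfolding square_summable_def by (intro infsum_mono2) auto
    finally show ?thesis .
  qed
  define u where "u \<xi> = Abs_ell2 (t (coeff \<xi>))" for \<xi>
  have cu: "coeff (u \<xi>) = t (coeff \<xi>)" for \<xi>
    unfolding u_def by (rule Abs_ell2_inverse) (simp add: tsumm square_summable_coeff)
  have bl: "bounded_linear u"
  proof (rule bounded_linear_intro[where K = 1])
    show "u (\<xi> + \<eta>) = u \<xi> + u \<eta>" for \<xi> \<eta>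
      unfolding coeff_inject[symmetric] cu plus_ell2.rep_eq by (simp add: t_def fun_eq_iff)
    show "u (r *\<^sub>R \<xi>) = r *\<^sub>R u \<xi>" for r \<xi>
      unfolding coeff_inject[symmetric] cu scaleR_ell2.rep_eq by (simp add: t_def fun_eq_iff)
    show "norm (u \<xi>) \<le> norm \<xi> * 1" for \<xi>
    proof -
      have "(norm (u \<xi>))\<^sup>2 \<le> (norm \<xi>)\<^sup>2"
        unfolding norm_ell2_square cu by (rule tnorm[OF square_summable_coeff])
      then show ?thesis
        unfolding mult_1_right by (rule power2_le_imp_le[OF _ norm_ge_zero])
    qed
  qed
  show ?thesis
  proof (rule that[of "Blinfun u"])
    show "Blinfun u \<in> bounded_ops"
      unfolding bounded_ops_def mem_Collect_eq bounded_linear_Blinfun_apply[OF bl]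
        coeff_inject[symmetric] cu cscale.rep_eq
      by (simp add: t_def fun_eq_iff)
    show "Blinfun u (ket x) = (case f x of Some y \<Rightarrow> ket y | None \<Rightarrow> 0)" for x
    proof -
      have "t (coeff (ket x)) y = coeff (case f x of Some y \<Rightarrow> ket y | None \<Rightarrow> 0) y" for y
      proof (cases "y \<in> ran f")
        case True
        then obtain x' where x': "f x' = Some y" by (auto simp: ran_def)
        then have "f x = Some y \<longleftrightarrow> x' = x" using g by metis
        then show ?thesis
          using True g[OF x'] x'
          by (cases "f x") (auto simp: t_def ket.rep_eq zero_ell2.rep_eq)
      next
        case False
        then have "f x \<noteq> Some y" by (auto simp: ran_def)
        with False show ?thesis
          by (cases "f x") (auto simp: t_def ket.rep_eq zero_ell2.rep_eq)
      qed
      then show ?thesis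
        by (simp only: bounded_linear_Blinfun_apply[OF bl] coeff_inject[symmetric] cu fun_eq_iff)
           blast
    qed
  qed
qed

lemma basis_op:
  assumes "inj_on f (dom f)"
  shows "basis_op f \<in> bounded_ops"
    and basis_op_ket: "basis_op f (ket x) = (case f x of Some y \<Rightarrow> ket y | None \<Rightarrow> 0)"
proof -
  obtain T where T: "T \<in> bounded_ops"
    "\<And>x. T (ket x) = (case f x of Some y \<Rightarrow> ket y | None \<Rightarrow> 0)"
    using basis_op_exists[OF assms] by blast
  have "basis_op f \<in> bounded_ops \<and>
    (\<forall>x. basis_op f (ket x) = (case f x of Some y \<Rightarrow> ket y | None \<Rightarrow> 0))"
    unfolding basis_op_def
  proof (rule theI)
    show "T \<in> bounded_ops \<and> (\<forall>x. T (ket x) = (case f x of Some y \<Rightarrow> ket y | None \<Rightarrow> 0))"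
      using T by blast
  next
    fix T' assume T': "T' \<in> bounded_ops \<and>
      (\<forall>x. T' (ket x) = (case f x of Some y \<Rightarrow> ket y | None \<Rightarrow> 0))"
    show "T' = T"
    proof (rule bounded_ops_eqI)
      show "T' \<in> bounded_ops" "T \<in> bounded_ops" using T' T(1) by blast+
      show "T' (ket x) = T (ket x)" for x using T' T(2)[of x] by metis
    qed
  qed
  then show "basis_op f \<in> bounded_ops"
    and "basis_op f (ket x) = (case f x of Some y \<Rightarrow> ket y | None \<Rightarrow> 0)" by blast+
qed


section \<open>Complex *-algebras, their quotients and homomorphisms\<close>

record 'b star_algebra = "(complex, 'b) module" +
  star :: "'b \<Rightarrow> 'b"

definition op_algebra :: "'x op set \<Rightarrow> 'x op star_algebra" where
  "op_algebra A =
     \<lparr>carrier = A, monoid.mult = (o\<^sub>L), one = id_blinfun, ring.zero = 0, add = (+),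
      smult = op_scale, star = adj\<rparr>"

definition quotient_algebra :: "'b star_algebra \<Rightarrow> 'b set \<Rightarrow> 'b set star_algebra" where
  "quotient_algebra R I =
     \<lparr>carrier = carrier (R Quot I), monoid.mult = monoid.mult (R Quot I), one = one (R Quot I),
      ring.zero = ring.zero (R Quot I), add = add (R Quot I),
      smult = (\<lambda>c X. \<Union>x\<in>X. I +>\<^bsub>R\<^esub> (c \<odot>\<^bsub>R\<^esub> x)),
      star = (\<lambda>X. \<Union>x\<in>X. I +>\<^bsub>R\<^esub> star R x)\<rparr>"

text \<open>
  No continuity is required of a *-homomorphism: between C*-algebras it is automatically
  contractive, and a bijective one is automatically isometric.
\<close>

definition star_hom :: "'b star_algebra \<Rightarrow> 'c star_algebra \<Rightarrow> ('b \<Rightarrow> 'c) \<Rightarrow> bool" where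
  "star_hom A B h \<longleftrightarrow>
     h \<in> carrier A \<rightarrow> carrier B \<and>
     (\<forall>x\<in>carrier A. \<forall>y\<in>carrier A. h (x \<oplus>\<^bsub>A\<^esub> y) = h x \<oplus>\<^bsub>B\<^esub> h y) \<and>
     (\<forall>x\<in>carrier A. \<forall>y\<in>carrier A. h (x \<otimes>\<^bsub>A\<^esub> y) = h x \<otimes>\<^bsub>B\<^esub> h y) \<and>
     (\<forall>c. \<forall>x\<in>carrier A. h (c \<odot>\<^bsub>A\<^esub> x) = c \<odot>\<^bsub>B\<^esub> h x) \<and>
     (\<forall>x\<in>carrier A. h (star A x) = star B (h x))"

definition star_iso :: "'b star_algebra \<Rightarrow> 'c star_algebra \<Rightarrow> ('b \<Rightarrow> 'c) \<Rightarrow> bool" where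
  "star_iso A B h \<longleftrightarrow> star_hom A B h \<and> bij_betw h (carrier A) (carrier B)"


section \<open>Inverse semigroups and their reduced C*-algebras\<close>

class inverse_semigroup = semigroup_mult +
  fixes adjoint_elem :: "'a \<Rightarrow> 'a" (\<open>(_\<^sup>\<star>)\<close> [1000] 999)
  assumes mult_adjoint_mult: "p * p\<^sup>\<star> * p = p"
    and adjoint_mult_adjoint: "p\<^sup>\<star> * p * p\<^sup>\<star> = p\<^sup>\<star>"
    and adjoint_unique: "p * q * p = p \<Longrightarrow> q * p * q = q \<Longrightarrow> q = p\<^sup>\<star>"

definition Lam :: "'p::inverse_semigroup \<Rightarrow> 'p op" where
  "Lam p = basis_op (\<lambda>q. if p\<^sup>\<star> * p * q = q then Some (p * q) else None)"

lemma Lam_ket: "Lam p (ket q) = (if p\<^sup>\<star> * p * q = q then ket (p * q) else 0)"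
proof -
  have "inj_on (\<lambda>q. if p\<^sup>\<star> * p * q = q then Some (p * q) else None)
      (dom (\<lambda>q. if p\<^sup>\<star> * p * q = q then Some (p * q) else None))"
    by (auto simp: inj_on_def dom_def split: if_splits) (metis mult.assoc)
  then show ?thesis unfolding Lam_def by (simp add: basis_op_ket)
qed

definition reduced_inverse_cstar :: "'p::inverse_semigroup op set" where
  "reduced_inverse_cstar = closure (complex_op.span (range Lam))"


section \<open>Left cancellative semigroups and their left inverse hulls\<close>

class left_cancel_monoid = monoid_mult +
  assumes left_cancel: "s * r = s * t \<Longrightarrow> r = t"

definition left_mult :: "'a::left_cancel_monoid \<Rightarrow> 'a \<Rightarrow> 'a option" where
  "left_mult s = (\<lambda>t. Some (s * t))"

definition partial_inverse :: "('a \<Rightarrow> 'a option) \<Rightarrow> 'a \<Rightarrow> 'a option" where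
  "partial_inverse f y = (if y \<in> ran f then Some (THE x. f x = Some y) else None)"

inductive_set left_inverse_hull :: "('a::left_cancel_monoid \<Rightarrow> 'a option) set" where
  "left_mult s \<in> left_inverse_hull"
| "f \<in> left_inverse_hull \<Longrightarrow> g \<in> left_inverse_hull \<Longrightarrow> f \<circ>\<^sub>m g \<in> left_inverse_hull"
| "f \<in> left_inverse_hull \<Longrightarrow> partial_inverse f \<in> left_inverse_hull"

lemma partial_inverse_iff:
  assumes "inj_on f (dom f)"
  shows "partial_inverse f y = Some x \<longleftrightarrow> f x = Some y"
proof -
  have u: "(THE x. f x = Some y) = x" if "f x = Some y" for x
  proof (rule the_equality)
    show "f x = Some y" by (fact that)
    show "x' = x" if "f x' = Some y" for x'
      using inj_onD[OF assms, of x' x] that \<open>f x = Some y\<close> by auto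
  qed
  show ?thesis
  proof (cases "y \<in> ran f")
    case True
    then obtain x' where "f x' = Some y" by (auto simp: ran_def)
    with True u[OF this] u show ?thesis unfolding partial_inverse_def by auto
  next
    case False
    then show ?thesis by (auto simp: partial_inverse_def ran_def)
  qed
qed

lemma inj_on_dom_iff: "inj_on f (dom f) \<longleftrightarrow> (\<forall>x x' y. f x = Some y \<and> f x' = Some y \<longrightarrow> x = x')"
  unfolding inj_on_def by (auto simp: dom_def)

lemma map_comp_eq_Some_iff: "(f \<circ>\<^sub>m g) x = Some z \<longleftrightarrow> (\<exists>y. g x = Some y \<and> f y = Some z)"
  by (auto simp: map_comp_def split: option.splits)

lemma inj_left_inverse_hull: "f \<in> left_inverse_hull \<Longrightarrow> inj_on f (dom f)"
proof (induction rule: left_inverse_hull.induct)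
  case (1 s)
  then show ?case by (auto simp: inj_on_def left_mult_def intro: left_cancel)
next
  case (2 f g)
  then show ?case
    unfolding inj_on_dom_iff map_comp_eq_Some_iff by metis
next
  case (3 f)
  then show ?case
    unfolding inj_on_dom_iff[of "partial_inverse f"] by (auto simp: partial_inverse_iff)
qed

typedef (overloaded) 'a Il = "left_inverse_hull :: ('a::left_cancel_monoid \<Rightarrow> 'a option) set"
  morphisms pmap Abs_Il
  using left_inverse_hull.intros(1) by blast

setup_lifting type_definition_Il

instantiation Il :: (left_cancel_monoid) inverse_semigroup
begin

lift_definition times_Il :: "'a Il \<Rightarrow> 'a Il \<Rightarrow> 'a Il" is "(\<circ>\<^sub>m)"
  by (rule left_inverse_hull.intros)
lift_definition adjoint_elem_Il :: "'a Il \<Rightarrow> 'a Il" is partial_inverse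
  by (rule left_inverse_hull.intros)

instance
proof
  fix p q r :: "'a Il"
  have map_eqI: "f = g" if "\<And>x y. f x = Some y \<longleftrightarrow> g x = Some y" for f g :: "'a \<Rightarrow> 'a option"
    using that by (metis ext not_Some_eq)
  note inj = inj_left_inverse_hull[OF pmap]
  have injD: "x = x'" if "pmap p x = Some y" "pmap p x' = Some y" for p :: "'a Il" and x x' y
    using inj[of p] that unfolding inj_on_dom_iff by blast
  note [simp] = times_Il.rep_eq adjoint_elem_Il.rep_eq map_comp_eq_Some_iff partial_inverse_iff[OF inj]
  show "p * q * r = p * (q * r)"
    unfolding pmap_inject[symmetric] by (rule map_eqI) auto
  show "p * p\<^sup>\<star> * p = p" "p\<^sup>\<star> * p * p\<^sup>\<star> = p\<^sup>\<star>"
    unfolding pmap_inject[symmetric] by (rule map_eqI; simp; metis injD)+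
  show "q = p\<^sup>\<star>" if "p * q * p = p" "q * p * q = q"
  proof -
    have *: "pmap q y = Some x" if eq: "p * q * p = p" and px: "pmap p x = Some y" for p q :: "'a Il" and x y
    proof -
      have "pmap (p * q * p) x = Some y" using px unfolding eq .
      then obtain z where "pmap q y = Some z" "pmap p z = Some y" using px by auto
      then show ?thesis using injD px by metis
    qed
    show ?thesis
      unfolding pmap_inject[symmetric] by (rule map_eqI) (simp, metis *[OF that(1)] *[OF that(2)])
  qed
qed

end

text \<open>
  Here \<open>P\<close> is a set of partial maps under \<open>\<circ>\<^sub>m\<close>; its zero, if present, is the nowhere defined
  map, and not just any absorbing element of \<open>P\<close>.
\<close>

definition E_star_unitary :: "('a \<Rightarrow> 'a option) set \<Rightarrow> bool" where
  "E_star_unitary P \<longleftrightarrow>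
     (\<forall>p\<in>P. \<forall>q\<in>P. p \<circ>\<^sub>m q = q \<and> q \<noteq> Map.empty \<longrightarrow> p \<circ>\<^sub>m p = p)"

text \<open>
  The ideal spanned by \<open>Lam 0\<close>, which is to be divided out if the hull contains the empty map
  \<open>0\<close>. If it does not, the ideal is trivial and the quotient is the algebra itself, with each
  operator \<open>T\<close> represented by the coset \<open>{T}\<close>.
\<close>

definition zero_ideal :: "'a::left_cancel_monoid Il op set" where
  "zero_ideal =
     (if Map.empty \<in> (left_inverse_hull :: ('a \<Rightarrow> 'a option) set)
      then {op_scale c (Lam (Abs_Il Map.empty)) | c. True} else {0})"

definition Cstar_r0_Il :: "'a::left_cancel_monoid Il op set star_algebra" where
  "Cstar_r0_Il = quotient_algebra (op_algebra reduced_inverse_cstar) zero_ideal"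

definition Lam0 :: "'a::left_cancel_monoid Il \<Rightarrow> 'a Il op set" where
  "Lam0 f = zero_ideal +>\<^bsub>op_algebra reduced_inverse_cstar\<^esub> Lam f"

definition V :: "'a::left_cancel_monoid \<Rightarrow> 'a op" where
  "V s = basis_op (left_mult s)"

lemma V_ket: "V s (ket t) = ket (s * t)"
  unfolding V_def
  by (simp add: basis_op_ket inj_left_inverse_hull left_inverse_hull.intros(1)) (simp add: left_mult_def)

definition Cstar_r :: "'a::left_cancel_monoid op star_algebra" where
  "Cstar_r = op_algebra (cstar_generated (range V))"

definition omega :: "'a::left_cancel_monoid Il \<Rightarrow> 'a op" where
  "omega f = basis_op (pmap f)"

lemma omega_ket: "omega f (ket s) = (case pmap f s of Some t \<Rightarrow> ket t | None \<Rightarrow> 0)"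
  unfolding omega_def by (rule basis_op_ket[OF inj_left_inverse_hull[OF pmap]])

text \<open>
  The right ideal obtained from the list \<open>[(t\<^sub>1, s\<^sub>1), \<dots>, (t\<^sub>n, s\<^sub>n)]\<close> by
  applying \<open>s\<^sub>n\<close>, then the preimage under \<open>t\<^sub>n\<close>, and so on, to the whole semigroup.
\<close>

definition ideal_word :: "('a::left_cancel_monoid \<times> 'a) list \<Rightarrow> 'a set" where
  "ideal_word w = foldr (\<lambda>(t, s) X. {r. t * r \<in> (\<lambda>x. s * x) ` X}) w UNIV"

definition J :: "'a::left_cancel_monoid set set" where
  "J = {\<Inter>F | F. finite F \<and> F \<noteq> {} \<and> F \<subseteq> {ideal_word w | w. w \<noteq> []}}"

definition independent_family :: "'a set set \<Rightarrow> bool" where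
  "independent_family \<J> \<longleftrightarrow>
     (\<forall>F Y. finite F \<and> F \<noteq> {} \<and> F \<subseteq> \<J> \<and> Y \<in> \<J> \<and> \<Union>F = Y \<longrightarrow> (\<exists>X\<in>F. X = Y))"

end

(*
  Composing h with the quotient map gives a star homomorphism phi from C*_r(I_l(S)) to B(l^2(S)).
  It is contractive: for norm a < 1 the operator 1 - a* a is the square of a self-adjoint element,
  so 1 - phi(a)* phi(a) is positive.

  Since elements of I_l(S) commute with right translations, E*-unitarity says that f(s) = s, or
  f q = q with q nonzero, forces f to be idempotent. Hence on the span of the Lam f the diagonal
  coefficients of y at q and of phi(y) at s agree as soon as s separates ran q from the domains
  involved that do not contain it; independence of J provides such an s. Therefore
  norm (y delta_q) <= norm (phi y) for all nonzero q, and iterating a* a turns these vectorwise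
  bounds into norm a <= norm (phi a) modulo the span of Lam 0. So phi is injective modulo that span
  and has closed range.

  Conversely, if the X_i cover Y and are proper subsets, the product of the Lam e_Y - Lam e_(X_i)
  is killed by phi, but it fixes the basis vector at e_Y.
*)
theory Submission
  imports Defs
begin

section \<open>Hilbert space preliminaries\<close>

text \<open>The homomorphism \<open>h\<close> is given purely algebraically, so continuity has to be
  derived before anything passes from the span of the operators \<open>Lam f\<close> to its closure.
  Bounds on basis vectors alone do not bound an operator norm. They suffice here because they hold
  for every element of the algebra, in particular for all powers of a* a, with norm (phi a)^(2k) on
  the right. This takes the place of a faithful conditional expectation onto the diagonal. Closed
  range matters because C*_r(S) is the smallest closed star-algebra containing the
  \<open>V s\<close>, so that surjectivity follows from minimality. The basis vector at the empty
  map is out of reach of E*-unitarity; every element of the algebra acts on it by a scalar, and this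
  scalar is what the quotient removes.\<close>

lemma square_summableI:
  assumes "\<And>F. finite F \<Longrightarrow> (\<Sum>x\<in>F. (cmod (f x))\<^sup>2) \<le> C"
  shows "square_summable f"
  unfolding square_summable_def
  by (rule nonneg_bdd_above_summable_on) (auto intro!: bdd_aboveI2[where M = C] assms)

lemma norm_ell2_leI:
  assumes "0 \<le> C" "\<And>F. finite F \<Longrightarrow> (\<Sum>x\<in>F. (cmod (coeff \<xi> x))\<^sup>2) \<le> C\<^sup>2"
  shows "norm \<xi> \<le> C"
proof -
  have "(norm \<xi>)\<^sup>2 \<le> C\<^sup>2"
    unfolding norm_ell2_square
    using square_summable_coeff[of \<xi>] assms(2)
    by (intro infsum_le_finite_sums) (auto simp: square_summable_def)
  then show ?thesis using assms(1) by (rule power2_le_imp_le)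
qed

lemma sum_coeff_le_norm:
  assumes "finite F"
  shows "(\<Sum>x\<in>F. (cmod (coeff \<xi> x))\<^sup>2) \<le> (norm \<xi>)\<^sup>2"
  unfolding norm_ell2_square
  using square_summable_coeff[of \<xi>] assms
  by (intro finite_sum_le_infsum) (auto simp: square_summable_def)

lemma coeff_le_norm: "cmod (coeff \<xi> x) \<le> norm \<xi>"
proof -
  have "(cmod (coeff \<xi> x))\<^sup>2 \<le> (norm \<xi>)\<^sup>2"
    using sum_coeff_le_norm[of "{x}" \<xi>] by simp
  then show ?thesis by (rule power2_le_imp_le) simp
qed

lemma bounded_linear_coeff: "bounded_linear (\<lambda>\<xi>. coeff \<xi> x)"
  by (rule bounded_linear_intro[where K = 1])
    (simp_all add: plus_ell2.rep_eq scaleR_ell2.rep_eq coeff_le_norm scaleR_conv_of_real)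

lemmas tendsto_coeff = bounded_linear.tendsto[OF bounded_linear_coeff]
lemmas coeff_simps = plus_ell2.rep_eq minus_ell2.rep_eq uminus_ell2.rep_eq zero_ell2.rep_eq
  scaleR_ell2.rep_eq cscale.rep_eq ket.rep_eq

text \<open>Coordinates of a Cauchy sequence converge, and bounds on finite partial sums survive the
  limit. Completeness passes to the operator space, where it serves a fixed point argument and the
  limits of lifted Cauchy sequences.\<close>

instance ell2 :: (type) banach
proof
  fix X :: "nat \<Rightarrow> 'a ell2"
  assume X: "Cauchy X"
  have "Cauchy (\<lambda>n. coeff (X n) x)" for x
    by (rule bounded_linear.Cauchy[OF bounded_linear_coeff X])
  then have "\<exists>c. (\<lambda>n. coeff (X n) x) \<longlonglongrightarrow> c" for x
    by (simp add: Cauchy_convergent_iff convergent_def)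
  then obtain f where f: "(\<lambda>n. coeff (X n) x) \<longlonglongrightarrow> f x" for x
    by metis
  obtain B where B: "norm (X n) \<le> B" for n
    using Cauchy_Bseq[OF X] unfolding Bseq_def by blast
  have "square_summable f"
  proof (rule square_summableI)
    fix F :: "'a set" assume "finite F"
    then have "(\<Sum>x\<in>F. (cmod (coeff (X n) x))\<^sup>2) \<le> B\<^sup>2" for n
      using sum_coeff_le_norm[of F "X n"] power_mono[OF B[of n], of 2] by simp
    moreover have "(\<lambda>n. \<Sum>x\<in>F. (cmod (coeff (X n) x))\<^sup>2) \<longlonglongrightarrow> (\<Sum>x\<in>F. (cmod (f x))\<^sup>2)"
      by (intro tendsto_intros f)
    ultimately show "(\<Sum>x\<in>F. (cmod (f x))\<^sup>2) \<le> B\<^sup>2"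
      by (meson LIMSEQ_le_const2)
  qed
  then have cf: "coeff (Abs_ell2 f) = f" by (simp add: Abs_ell2_inverse)
  have "X \<longlonglongrightarrow> Abs_ell2 f"
  proof (rule LIMSEQ_I)
    fix r :: real assume "0 < r"
    then obtain M where M: "norm (X m - X n) < r / 2" if "m \<ge> M" "n \<ge> M" for m n
      using CauchyD[OF X, of "r / 2"] by auto
    have "norm (X n - Abs_ell2 f) \<le> r / 2" if n: "n \<ge> M" for n
    proof (rule norm_ell2_leI)
      fix F :: "'a set" assume "finite F"
      have "(\<lambda>m. \<Sum>x\<in>F. (cmod (coeff (X n - X m) x))\<^sup>2) \<longlonglongrightarrow>
        (\<Sum>x\<in>F. (cmod (coeff (X n - Abs_ell2 f) x))\<^sup>2)"
        unfolding minus_ell2.rep_eq cf by (intro tendsto_intros f)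
      moreover have "\<forall>m\<ge>M. (\<Sum>x\<in>F. (cmod (coeff (X n - X m) x))\<^sup>2) \<le> (r / 2)\<^sup>2"
        using sum_coeff_le_norm[OF \<open>finite F\<close>] power_mono[OF less_imp_le[OF M[OF n]], of _ 2]
        by (meson norm_ge_zero order_trans)
      ultimately show "(\<Sum>x\<in>F. (cmod (coeff (X n - Abs_ell2 f) x))\<^sup>2) \<le> (r / 2)\<^sup>2"
        by (meson LIMSEQ_le_const2)
    qed (use \<open>0 < r\<close> in simp)
    then show "\<exists>no. \<forall>n\<ge>no. norm (X n - Abs_ell2 f) < r"
      using \<open>0 < r\<close> by (intro exI[of _ M]) (force intro: le_less_trans)
  qed
  then show "convergent X" by (rule convergentI)
qed

lemma cinner_ket_right: "cinner \<xi> (ket x) = coeff \<xi> x"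
proof -
  have "cinner \<xi> (ket x) = (\<Sum>\<^sub>\<infinity>y\<in>{x}. coeff \<xi> y * cnj (coeff (ket x) y))"
    unfolding cinner_def by (rule infsum_cong_neutral) (auto simp: ket.rep_eq)
  then show ?thesis by (simp add: ket.rep_eq)
qed

lemma cinner_ket_left: "cinner (ket x) \<xi> = cnj (coeff \<xi> x)"
  by (subst cinner_commute) (simp add: cinner_ket_right)

lemma norm_ket: "norm (ket x) = 1"
  by (simp add: norm_ell2_def inner_ell2_def cinner_ket_right ket.rep_eq)

lemma ket_neq_zero: "ket x \<noteq> 0"
  using norm_ket[of x] by force

lemma cinner_add_right: "cinner \<eta> (\<xi> + \<xi>') = cinner \<eta> \<xi> + cinner \<eta> \<xi>'"
  by (subst (1 2 3) cinner_commute) (simp add: cinner_add_left)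

lemma cinner_scale_right: "cinner \<eta> (c *\<^sub>C \<xi>) = cnj c * cinner \<eta> \<xi>"
  by (subst (1 2) cinner_commute) (simp add: cinner_scale_left)

lemma ell2_eqI:
  assumes "\<And>\<eta>. cinner \<eta> \<xi> = cinner \<eta> \<zeta>"
  shows "\<xi> = \<zeta>"
proof -
  have "coeff \<xi> x = coeff \<zeta> x" for x
    using assms[of "ket x"] by (simp add: cinner_ket_left)
  then show ?thesis by (simp add: coeff_inject[symmetric] fun_eq_iff)
qed

lemma inner_cscale_left: "inner (c *\<^sub>C \<xi>) \<eta> = Re (c * cinner \<xi> \<eta>)"
  by (simp add: inner_ell2_def cinner_scale_left)

text \<open>The real Cauchy-Schwarz inequality controls only the real part of \<open>cinner\<close>.
  Rotating \<xi> by the phase \<open>c\<close> makes the pairing real and nonnegative without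
  changing the norm.\<close>

lemma cmod_cinner_le: "cmod (cinner \<xi> \<eta>) \<le> norm \<xi> * norm \<eta>"
proof (cases "cinner \<xi> \<eta> = 0")
  case False
  define c where "c = cnj (sgn (cinner \<xi> \<eta>))"
  have "c * cinner \<xi> \<eta> = complex_of_real (cmod (cinner \<xi> \<eta>))"
    using False complex_norm_square[of "cinner \<xi> \<eta>"]
    unfolding c_def sgn_eq
    by (simp add: mult.commute power2_eq_square nonzero_divide_eq_eq)
  then have "cmod (cinner \<xi> \<eta>) = inner (c *\<^sub>C \<xi>) \<eta>"
    by (simp add: inner_cscale_left)
  also have "\<dots> \<le> norm (c *\<^sub>C \<xi>) * norm \<eta>" by (rule norm_cauchy_schwarz)
  also have "norm (c *\<^sub>C \<xi>) = norm \<xi>"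
    using False by (simp add: norm_cscale c_def norm_sgn)
  finally show ?thesis .
qed simp

section \<open>Adjoints\<close>

lemma bounded_opsD: "T \<in> bounded_ops \<Longrightarrow> T (c *\<^sub>C \<xi>) = c *\<^sub>C T \<xi>"
  by (simp add: bounded_ops_def)

lemma bounded_ops_closed_operations:
  "id_blinfun \<in> bounded_ops" "0 \<in> bounded_ops"
  "S \<in> bounded_ops \<Longrightarrow> T \<in> bounded_ops \<Longrightarrow> S + T \<in> bounded_ops"
  "S \<in> bounded_ops \<Longrightarrow> T \<in> bounded_ops \<Longrightarrow> S o\<^sub>L T \<in> bounded_ops"
  "T \<in> bounded_ops \<Longrightarrow> op_scale c T \<in> bounded_ops"
proof -
  have add: "c *\<^sub>C (\<xi> + \<eta>) = c *\<^sub>C \<xi> + c *\<^sub>C \<eta>" for c and \<xi> \<eta> :: "'x ell2"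
    by transfer (simp add: algebra_simps)
  have comm: "c *\<^sub>C (d *\<^sub>C \<xi>) = d *\<^sub>C (c *\<^sub>C \<xi>)" for c d and \<xi> :: "'x ell2"
    by transfer (simp add: algebra_simps)
  have zero: "c *\<^sub>C (0 :: 'x ell2) = 0" for c
    by transfer simp
  show "id_blinfun \<in> (bounded_ops :: 'x op set)" "0 \<in> (bounded_ops :: 'x op set)"
    by (simp_all add: bounded_ops_def zero)
  show "S \<in> bounded_ops \<Longrightarrow> T \<in> bounded_ops \<Longrightarrow> S + T \<in> bounded_ops" for S T :: "'x op"
    by (simp add: bounded_ops_def blinfun.add_left add)
  show "S \<in> bounded_ops \<Longrightarrow> T \<in> bounded_ops \<Longrightarrow> S o\<^sub>L T \<in> bounded_ops" for S T :: "'x op"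
    by (simp add: bounded_ops_def)
  show "T \<in> bounded_ops \<Longrightarrow> op_scale c T \<in> bounded_ops" for T :: "'x op"
    by (simp add: bounded_ops_def op_scale_apply comm)
qed

lemma closed_bounded_ops: "closed (bounded_ops :: 'x op set)"
proof -
  have "bounded_ops = (\<Inter>c. \<Inter>\<xi>. {T :: 'x op. T (c *\<^sub>C \<xi>) = c *\<^sub>C T \<xi>})"
    by (auto simp: bounded_ops_def)
  moreover have "closed {T :: 'x op. T (c *\<^sub>C \<xi>) = c *\<^sub>C T \<xi>}" for c \<xi>
    by (intro closed_Collect_eq continuous_intros
        bounded_linear.continuous_on[OF bounded_linear_cscale])
  ultimately show ?thesis by (metis (no_types, lifting) closed_INT)
qed

text \<open>The vector \<open>T' \<eta>\<close> must have the coordinates \<open>t \<eta> x\<close>,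
  so the heart of the matter is the square summability of this family.\<close>

lemma adj_exists:
  fixes T :: "'x op"
  assumes T: "T \<in> bounded_ops"
  obtains T' where "T' \<in> bounded_ops" "\<And>\<xi> \<eta>. cinner (T \<xi>) \<eta> = cinner \<xi> (T' \<eta>)"
proof -
  define t where "t \<eta> x = cinner \<eta> (T (ket x))" for \<eta> x
  have pairing: "cinner \<eta> (T (\<Sum>x\<in>F. c x *\<^sub>C ket x)) = (\<Sum>x\<in>F. cnj (c x) * t \<eta> x)"
    if "finite F" for \<eta> F c
    using that
  proof (induction F)
    case empty
    then show ?case by (simp add: blinfun.zero_right cinner_def zero_ell2.rep_eq)
  next
    case (insert x F)
    then show ?case
      by (simp add: blinfun.add_right cinner_add_right bounded_opsD[OF T] cinner_scale_right t_def)
  qed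
  have tF: "(\<Sum>x\<in>F. (cmod (t \<eta> x))\<^sup>2) \<le> (norm T * norm \<eta>)\<^sup>2" if F: "finite F" for \<eta> F
  proof -
    \<comment> \<open>A finite truncation of the sought vector. Pairing \<eta> with
      \<open>T \<zeta>\<close> returns the square of the norm of \<zeta>; Cauchy-Schwarz bounds it
      by a multiple of that norm, and one factor cancels.\<close>
    define \<zeta> where "\<zeta> = (\<Sum>x\<in>F. t \<eta> x *\<^sub>C ket x)"
    let ?s = "\<Sum>x\<in>F. (cmod (t \<eta> x))\<^sup>2"
    have c: "coeff \<zeta> y = (if y \<in> F then t \<eta> y else 0)" for y
      using F by (simp add: \<zeta>_def coeff_sum coeff_simps if_distrib sum.delta' cong: if_cong)
    have "(norm \<zeta>)\<^sup>2 = infsum (\<lambda>y. (cmod (t \<eta> y))\<^sup>2) F"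
      unfolding norm_ell2_square by (rule infsum_cong_neutral) (auto simp: c)
    then have n: "(norm \<zeta>)\<^sup>2 = ?s" using F by simp
    have "cinner \<eta> (T \<zeta>) = complex_of_real ?s"
      unfolding \<zeta>_def pairing[OF F] by (simp add: complex_norm_square mult.commute flip: of_real_power)
    moreover have "0 \<le> ?s" by (simp add: sum_nonneg)
    ultimately have "?s = cmod (cinner \<eta> (T \<zeta>))"
      by (metis abs_of_nonneg norm_of_real)
    also have "\<dots> \<le> norm \<eta> * norm (T \<zeta>)" by (rule cmod_cinner_le)
    also have "\<dots> \<le> norm \<eta> * (norm T * norm \<zeta>)"
      by (intro mult_left_mono norm_blinfun) simp
    finally have "norm \<zeta> * norm \<zeta> \<le> norm T * norm \<eta> * norm \<zeta>"
      unfolding n[symmetric] unfolding power2_eq_square by (simp only: ac_simps)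
    then have "norm \<zeta> \<le> norm T * norm \<eta>"
      by (cases "norm \<zeta> = 0") simp_all
    then have "(norm \<zeta>)\<^sup>2 \<le> (norm T * norm \<eta>)\<^sup>2"
      by (rule power_mono) simp
    then show ?thesis using n by simp
  qed
  define u where "u \<eta> = Abs_ell2 (t \<eta>)" for \<eta>
  have cu: "coeff (u \<eta>) = t \<eta>" for \<eta>
    unfolding u_def using square_summableI[OF tF] by (intro Abs_ell2_inverse) simp
  have bl: "bounded_linear u"
  proof (rule bounded_linear_intro[where K = "norm T"])
    show "u (\<xi> + \<eta>) = u \<xi> + u \<eta>" for \<xi> \<eta>
      unfolding coeff_inject[symmetric] cu plus_ell2.rep_eq by (simp add: t_def cinner_add_left fun_eq_iff)
    show "u (r *\<^sub>R \<xi>) = r *\<^sub>R u \<xi>" for r \<xi>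
      unfolding coeff_inject[symmetric] cu scaleR_ell2.rep_eq
      by (simp add: t_def scaleR_cscale cinner_scale_left fun_eq_iff)
    show "norm (u \<xi>) \<le> norm \<xi> * norm T" for \<xi>
      by (rule norm_ell2_leI) (use tF in \<open>simp_all add: cu mult.commute\<close>)
  qed
  have b: "Blinfun u \<in> bounded_ops"
    unfolding bounded_ops_def mem_Collect_eq bounded_linear_Blinfun_apply[OF bl]
      coeff_inject[symmetric] cu cscale.rep_eq
    by (simp add: t_def cinner_scale_left fun_eq_iff)
  have "cinner (T \<xi>) \<eta> = cinner \<xi> (Blinfun u \<eta>)" for \<xi> \<eta>
  proof -
    have fin: "cinner (T (\<Sum>x\<in>F. c x *\<^sub>C ket x)) \<eta> = cinner (\<Sum>x\<in>F. c x *\<^sub>C ket x) (u \<eta>)"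
      if "finite F" for F c
    proof -
      have "cinner (\<Sum>x\<in>F. c x *\<^sub>C ket x) (u \<eta>) = (\<Sum>x\<in>F. c x * cnj (t \<eta> x))"
        using that
        by induction (simp_all add: cinner_add_left cinner_scale_left cinner_ket_left cu
            cinner_def[of 0] zero_ell2.rep_eq)
      also have "\<dots> = cnj (cinner \<eta> (T (\<Sum>x\<in>F. c x *\<^sub>C ket x)))"
        unfolding pairing[OF that] by simp
      finally show ?thesis by (subst cinner_commute) (rule sym)
    qed
    have "cmod (cinner (T \<xi>) \<eta> - cinner \<xi> (u \<eta>)) \<le> 0 + e" if "e > 0" for e
    proof -
      \<comment> \<open>\<open>K\<close> absorbs both approximation errors, the one seen through
        \<open>T\<close> and the one paired with \<open>u \<eta>\<close>; the summand 1 keeps it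
        positive for the division.\<close>
      define K where "K = norm T * norm \<eta> + norm (u \<eta>) + 1"
      have K: "K > 0" unfolding K_def by (simp add: add_nonneg_pos)
      obtain F where F: "finite F" "norm (\<xi> - (\<Sum>x\<in>F. coeff \<xi> x *\<^sub>C ket x)) < e / K"
        using ket_approx[OF divide_pos_pos[OF \<open>e > 0\<close> K]] by metis
      define \<zeta> where "\<zeta> = (\<Sum>x\<in>F. coeff \<xi> x *\<^sub>C ket x)"
      have d: "cinner (\<alpha> - \<beta>) \<gamma> = cinner \<alpha> \<gamma> - cinner \<beta> \<gamma>" for \<alpha> \<beta> \<gamma> :: "'x ell2"
        using cinner_add_left[of "\<alpha> - \<beta>" \<beta> \<gamma>] by simp
      have "cinner (T \<xi>) \<eta> - cinner \<xi> (u \<eta>) = cinner (T (\<xi> - \<zeta>)) \<eta> - cinner (\<xi> - \<zeta>) (u \<eta>)"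
        using fin[OF F(1), of "coeff \<xi>"] by (simp add: d blinfun.diff_right \<zeta>_def)
      also have "cmod \<dots> \<le> norm (T (\<xi> - \<zeta>)) * norm \<eta> + norm (\<xi> - \<zeta>) * norm (u \<eta>)"
        by (intro order_trans[OF norm_triangle_ineq4] add_mono cmod_cinner_le)
      also have "\<dots> \<le> (norm T * norm (\<xi> - \<zeta>)) * norm \<eta> + norm (\<xi> - \<zeta>) * norm (u \<eta>)"
        by (intro add_mono mult_right_mono norm_blinfun) simp_all
      also have "\<dots> \<le> K * norm (\<xi> - \<zeta>)"
        by (simp add: K_def algebra_simps)
      also have "\<dots> \<le> K * (e / K)"
        using F(2) K unfolding \<zeta>_def by (intro mult_left_mono) auto
      finally show ?thesis using K by simp
    qed
    then have "cmod (cinner (T \<xi>) \<eta> - cinner \<xi> (u \<eta>)) \<le> 0"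
      by (rule field_le_epsilon)
    then show ?thesis by (simp add: bounded_linear_Blinfun_apply[OF bl])
  qed
  with b that show thesis by blast
qed

lemma adj_eqI:
  fixes T :: "'x op"
  assumes "T' \<in> bounded_ops" "\<And>\<xi> \<eta>. cinner (T \<xi>) \<eta> = cinner \<xi> (T' \<eta>)"
  shows "adj T = T'"
  unfolding adj_def
proof (rule the_equality)
  show "T'' = T'" if "T'' \<in> bounded_ops \<and> (\<forall>\<xi> \<eta>. cinner (T \<xi>) \<eta> = cinner \<xi> (T'' \<eta>))" for T''
    using that assms(2) by (intro blinfun_eqI ell2_eqI) metis
qed (use assms in blast)

lemma
  fixes T :: "'x op"
  assumes "T \<in> bounded_ops"
  shows adj_in_bounded_ops: "adj T \<in> bounded_ops"
    and cinner_adj_right: "cinner (T \<xi>) \<eta> = cinner \<xi> (adj T \<eta>)"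
proof -
  obtain T' where T': "T' \<in> bounded_ops" "\<And>\<xi> \<eta>. cinner (T \<xi>) \<eta> = cinner \<xi> (T' \<eta>)"
    using adj_exists[OF assms] by blast
  then have "adj T = T'" by (rule adj_eqI)
  with T' show "adj T \<in> bounded_ops" "cinner (T \<xi>) \<eta> = cinner \<xi> (adj T \<eta>)" by simp_all
qed

lemma cinner_adj_left: "T \<in> bounded_ops \<Longrightarrow> cinner (adj T \<xi>) \<eta> = cinner \<xi> (T \<eta>)"
  by (subst (1 2) cinner_commute) (simp add: cinner_adj_right)

lemma inner_adj_right: "T \<in> bounded_ops \<Longrightarrow> inner (T \<xi>) \<eta> = inner \<xi> (adj T \<eta>)"
  by (simp add: inner_ell2_def cinner_adj_right)

lemma adj_adj: "T \<in> bounded_ops \<Longrightarrow> adj (adj T) = T"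
  by (intro adj_eqI) (simp_all add: cinner_adj_left)

lemma adj_add: "S \<in> bounded_ops \<Longrightarrow> T \<in> bounded_ops \<Longrightarrow> adj (S + T) = adj S + adj T"
  by (intro adj_eqI) (simp_all add: bounded_ops_closed_operations adj_in_bounded_ops
      blinfun.add_left cinner_add_left cinner_add_right cinner_adj_right)

lemma adj_scale: "T \<in> bounded_ops \<Longrightarrow> adj (op_scale c T) = op_scale (cnj c) (adj T)"
  by (intro adj_eqI) (simp_all add: bounded_ops_closed_operations adj_in_bounded_ops
      op_scale_apply cinner_scale_left cinner_scale_right cinner_adj_right)

lemma adj_compose: "S \<in> bounded_ops \<Longrightarrow> T \<in> bounded_ops \<Longrightarrow> adj (S o\<^sub>L T) = adj T o\<^sub>L adj S"
  by (intro adj_eqI) (simp_all add: bounded_ops_closed_operations adj_in_bounded_ops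
      cinner_adj_right)

lemma adj_zero: "adj 0 = 0"
  by (intro adj_eqI) (simp_all add: bounded_ops_closed_operations cinner_def zero_ell2.rep_eq)

lemma op_scale_minus_one: "op_scale (-1) T = - T"
  using complex_op.scale_minus_left[of 1 T] by simp

lemma bounded_ops_diff: "S \<in> bounded_ops \<Longrightarrow> T \<in> bounded_ops \<Longrightarrow> S - T \<in> bounded_ops"
  using bounded_ops_closed_operations(3)[of S "op_scale (-1) T"]
    bounded_ops_closed_operations(5)[of T "-1"]
  by (simp add: op_scale_minus_one)

lemma adj_diff: "S \<in> bounded_ops \<Longrightarrow> T \<in> bounded_ops \<Longrightarrow> adj (S - T) = adj S - adj T"
  using adj_add[of S "op_scale (-1) T"] adj_scale[of T "-1"]
    bounded_ops_closed_operations(5)[of T "-1"]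
  by (simp add: op_scale_minus_one)

lemma norm_apply_square:
  "T \<in> bounded_ops \<Longrightarrow> (norm (T \<xi>))\<^sup>2 = inner \<xi> ((adj T o\<^sub>L T) \<xi>)"
  by (simp add: power2_norm_eq_inner inner_adj_right)

text \<open>The square of \<open>norm (adj T \<xi>)\<close> is a pairing of
  \<open>T (adj T \<xi>)\<close> with \<xi>, from which one factor cancels. This makes
  \<open>adj\<close> continuous, so that closures of star-algebras are stable under it.\<close>

lemma norm_adj: "T \<in> bounded_ops \<Longrightarrow> norm (adj T) = norm T"
proof -
  have le: "norm (adj T) \<le> norm T" if T: "T \<in> bounded_ops" for T :: "'x op"
  proof (rule norm_blinfun_bound)
    fix \<xi>
    have "(norm (adj T \<xi>))\<^sup>2 = inner (T (adj T \<xi>)) \<xi>"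
      using norm_apply_square[OF adj_in_bounded_ops[OF T], of \<xi>] T
      by (simp add: adj_adj inner_commute)
    also have "\<dots> \<le> (norm T * norm (adj T \<xi>)) * norm \<xi>"
      by (intro order_trans[OF norm_cauchy_schwarz] mult_right_mono norm_blinfun) simp
    finally have "norm (adj T \<xi>) * norm (adj T \<xi>) \<le> norm T * norm \<xi> * norm (adj T \<xi>)"
      by (simp add: power2_eq_square algebra_simps)
    then show "norm (adj T \<xi>) \<le> norm T * norm \<xi>"
      by (cases "norm (adj T \<xi>) = 0") simp_all
  qed simp
  assume "T \<in> bounded_ops"
  then show ?thesis
    using le[of T] le[of "adj T"] by (simp add: adj_adj adj_in_bounded_ops)
qed

lemma tendsto_adj:
  assumes "X \<longlonglongrightarrow> T" "\<And>n. X n \<in> bounded_ops" "T \<in> bounded_ops"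
  shows "(\<lambda>n. adj (X n)) \<longlonglongrightarrow> adj T"
proof -
  have "norm (adj (X n) - adj T) = norm (X n - T)" for n
    using assms(2,3) by (simp add: norm_adj bounded_ops_diff flip: adj_diff)
  moreover have "(\<lambda>n. norm (X n - T)) \<longlonglongrightarrow> 0"
    by (rule tendsto_norm_zero[OF LIM_zero[OF assms(1)]])
  ultimately have "(\<lambda>n. norm (adj (X n) - adj T)) \<longlonglongrightarrow> 0"
    by simp
  then show ?thesis
    by (rule LIM_zero_cancel[OF tendsto_norm_zero_cancel])
qed

lemma adj_basis_op:
  assumes inj: "inj_on f (dom f)"
  shows "adj (basis_op f) = basis_op (partial_inverse f)"
proof -
  note f = basis_op[OF inj]
  have inj': "inj_on (partial_inverse f) (dom (partial_inverse f))"
    by (auto simp: inj_on_dom_iff partial_inverse_iff[OF inj])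
  note f' = basis_op[OF inj']
  show ?thesis
  proof (rule bounded_ops_eqI)
    show "adj (basis_op f) \<in> bounded_ops" by (rule adj_in_bounded_ops[OF f(1)])
    show "basis_op (partial_inverse f) \<in> bounded_ops" by (fact f')
    fix y
    have "coeff (adj (basis_op f) (ket y)) x = coeff (basis_op (partial_inverse f) (ket y)) x" for x
    proof -
      have "coeff (adj (basis_op f) (ket y)) x = cnj (coeff (basis_op f (ket x)) y)"
        unfolding cinner_ket_right[symmetric] cinner_adj_left[OF f(1)] by (rule cinner_commute)
      also have "\<dots> = (if f x = Some y then 1 else 0)"
        by (cases "f x") (auto simp: f(2) coeff_simps)
      also have "\<dots> = coeff (basis_op (partial_inverse f) (ket y)) x"
        using partial_inverse_iff[OF inj, of y x]
        by (cases "partial_inverse f y") (auto simp: f'(2) coeff_simps)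
      finally show ?thesis .
    qed
    then show "adj (basis_op f) (ket y) = basis_op (partial_inverse f) (ket y)"
      by (simp add: coeff_inject[symmetric] fun_eq_iff)
  qed
qed

section \<open>Star homomorphisms between operator algebras\<close>

lemma op_scale_of_real: "op_scale (complex_of_real r) T = r *\<^sub>R T"
  by (rule blinfun_eqI) (simp add: op_scale_apply blinfun.scaleR_left scaleR_cscale)

lemma bounded_linear_op_scale: "bounded_linear (op_scale c :: 'x op \<Rightarrow> 'x op)"
proof (rule bounded_linear_intro[where K = "cmod c"])
  fix S T :: "'x op" and r :: real
  show "op_scale c (S + T) = op_scale c S + op_scale c T"
    by (rule complex_op.scale_right_distrib)
  show "op_scale c (r *\<^sub>R T) = r *\<^sub>R op_scale c T"
    by (simp add: mult.commute flip: op_scale_of_real)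
  show "norm (op_scale c T) \<le> norm T * cmod c"
  proof (rule norm_blinfun_bound)
    show "norm (op_scale c T \<xi>) \<le> norm T * cmod c * norm \<xi>" for \<xi>
      using mult_left_mono[OF norm_blinfun[of T \<xi>], of "cmod c"]
      by (simp add: op_scale_apply norm_cscale ac_simps)
  qed simp
qed

lemma cstar_subalgebra_closure:
  assumes D: "D \<subseteq> bounded_ops" "0 \<in> D"
    and add: "\<And>S T. S \<in> D \<Longrightarrow> T \<in> D \<Longrightarrow> S + T \<in> D"
    and scale: "\<And>c T. T \<in> D \<Longrightarrow> op_scale c T \<in> D"
    and comp: "\<And>S T. S \<in> D \<Longrightarrow> T \<in> D \<Longrightarrow> S o\<^sub>L T \<in> D"
    and adj: "\<And>T. T \<in> D \<Longrightarrow> adj T \<in> D"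
  shows "cstar_subalgebra (closure D)"
proof -
  have b: "closure D \<subseteq> bounded_ops"
    by (rule closure_minimal[OF D(1) closed_bounded_ops])
  have closureI: "T \<in> closure D" if "X \<longlonglongrightarrow> T" "\<And>n. X n \<in> D" for X T
    unfolding closure_sequential using that by blast
  have "S + T \<in> closure D \<and> S o\<^sub>L T \<in> closure D" if ST: "S \<in> closure D" "T \<in> closure D" for S T
  proof -
    obtain X where X: "\<forall>n. X n \<in> D" "X \<longlonglongrightarrow> S"
      using ST(1) unfolding closure_sequential by blast
    obtain Y where Y: "\<forall>n. Y n \<in> D" "Y \<longlonglongrightarrow> T"
      using ST(2) unfolding closure_sequential by blast
    show ?thesis
    proof
      show "S + T \<in> closure D"
        by (rule closureI[OF tendsto_add[OF X(2) Y(2)]]) (simp add: X Y add)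
      show "S o\<^sub>L T \<in> closure D"
        by (rule closureI[OF bounded_bilinear.tendsto[OF bounded_bilinear_blinfun_compose X(2) Y(2)]])
          (simp add: X Y comp)
    qed
  qed
  moreover have "op_scale c T \<in> closure D \<and> adj T \<in> closure D" if T: "T \<in> closure D" for c T
  proof -
    obtain X where X: "\<forall>n. X n \<in> D" "X \<longlonglongrightarrow> T"
      using T unfolding closure_sequential by blast
    show ?thesis
    proof
      show "op_scale c T \<in> closure D"
        by (rule closureI[OF bounded_linear.tendsto[OF bounded_linear_op_scale X(2)]])
          (simp add: X scale)
      have "(\<lambda>n. adj (X n)) \<longlonglongrightarrow> adj T"
        using X(1) D(1) b T by (intro tendsto_adj[OF X(2)]) blast+
      then show "adj T \<in> closure D"
        by (rule closureI) (simp add: X adj)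
    qed
  qed
  ultimately show ?thesis
    unfolding cstar_subalgebra_def using b closure_subset[of D] D(2) by auto
qed

lemma cstar_subalgebra_bounded_ops: "cstar_subalgebra bounded_ops"
  by (simp add: cstar_subalgebra_def closed_bounded_ops bounded_ops_closed_operations
      adj_in_bounded_ops)

lemma cstar_generated_bounded:
  "G \<subseteq> bounded_ops \<Longrightarrow> cstar_generated G \<subseteq> bounded_ops"
  unfolding cstar_generated_def using cstar_subalgebra_bounded_ops by blast

lemma cstar_generated_minimal:
  "cstar_subalgebra A \<Longrightarrow> G \<subseteq> A \<Longrightarrow> cstar_generated G \<subseteq> A"
  unfolding cstar_generated_def by blast

section \<open>Norm estimates for star representations\<close>

lemma power_two_power_bound:
  fixes v M C :: real
  assumes "0 \<le> M" and le: "\<And>n. v ^ (2 ^ n) \<le> C * M ^ (2 ^ n)"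
  shows "v \<le> M"
proof (cases "M = 0")
  case True
  then show ?thesis using le[of 0] by simp
next
  case False
  with assms(1) have M: "0 < M" by simp
  show ?thesis
  proof (rule ccontr)
    \<comment> \<open>The ratio \<open>v / M\<close> would exceed 1, so some power of it would
      exceed \<open>C\<close>; the larger exponent 2^m then contradicts the hypothesis.\<close>
    assume "\<not> v \<le> M"
    then have 1: "1 < v / M" using M by simp
    then obtain m where m: "C < (v / M) ^ m" using real_arch_pow by blast
    also have "(v / M) ^ m \<le> (v / M) ^ (2 ^ m)"
      using 1 by (intro power_increasing) (simp_all add: less_imp_le)
    also have "\<dots> \<le> C"
      using le[of m] M by (simp add: power_divide divide_le_eq)
    finally show False by simp
  qed
qed

text \<open>Abstracts \<open>h\<close> composed with the quotient map. The axioms are algebraic,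
  contractivity being derived in \<open>norm_le\<close>. As \<open>A\<close> need not contain the
  identity, the arguments below stay inside \<open>A\<close>.\<close>

locale star_rep =
  fixes A :: "'x op set" and \<phi> :: "'x op \<Rightarrow> 'y op"
  assumes subalgebra: "cstar_subalgebra A"
    and range_bounded: "T \<in> A \<Longrightarrow> \<phi> T \<in> bounded_ops"
    and add: "S \<in> A \<Longrightarrow> T \<in> A \<Longrightarrow> \<phi> (S + T) = \<phi> S + \<phi> T"
    and scale: "T \<in> A \<Longrightarrow> \<phi> (op_scale c T) = op_scale c (\<phi> T)"
    and compose: "S \<in> A \<Longrightarrow> T \<in> A \<Longrightarrow> \<phi> (S o\<^sub>L T) = \<phi> S o\<^sub>L \<phi> T"
    and adj: "T \<in> A \<Longrightarrow> \<phi> (adj T) = adj (\<phi> T)"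
begin

lemma A_bounded: "T \<in> A \<Longrightarrow> T \<in> bounded_ops"
  and A_closed: "closed A"
  and A_zero: "0 \<in> A"
  and A_add: "S \<in> A \<Longrightarrow> T \<in> A \<Longrightarrow> S + T \<in> A"
  and A_scale: "T \<in> A \<Longrightarrow> op_scale c T \<in> A"
  and A_compose: "S \<in> A \<Longrightarrow> T \<in> A \<Longrightarrow> S o\<^sub>L T \<in> A"
  and A_adj: "T \<in> A \<Longrightarrow> adj T \<in> A"
  using subalgebra by (auto simp: cstar_subalgebra_def)

lemma A_scaleR: "T \<in> A \<Longrightarrow> r *\<^sub>R T \<in> A"
  using A_scale[of T "complex_of_real r"] by (simp add: op_scale_of_real)

lemma scaleR: "T \<in> A \<Longrightarrow> \<phi> (r *\<^sub>R T) = r *\<^sub>R \<phi> T"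
  using scale[of T "complex_of_real r"] by (simp add: op_scale_of_real)

lemma A_diff: "S \<in> A \<Longrightarrow> T \<in> A \<Longrightarrow> S - T \<in> A"
  using A_add[of S "(-1) *\<^sub>R T"] A_scaleR[of T "-1"] by simp

lemma zero: "\<phi> 0 = 0"
  using scaleR[OF A_zero, of 0] by simp

lemma diff: "S \<in> A \<Longrightarrow> T \<in> A \<Longrightarrow> \<phi> (S - T) = \<phi> S - \<phi> T"
  using add[of S "(-1) *\<^sub>R T"] scaleR[of T "-1"] A_scaleR[of T "-1"] by simp

text \<open>
  If \<open>b\<close> is a self-adjoint solution of \<open>2 b = a\<^sup>* a + b\<^sup>2\<close>, then \<open>(1 - b)\<^sup>2 = 1 - a\<^sup>* a\<close>, so that
  \<open>1 - \<phi> (a\<^sup>* a)\<close> is a square of a self-adjoint operator and hence positive.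
\<close>

lemma norm_le_one:
  assumes a: "a \<in> A" and less: "norm a < 1"
  shows "norm (\<phi> a) \<le> 1"
proof -
  define x where "x = adj a o\<^sub>L a"
  define r where "r = norm a * norm a"
  have r: "0 \<le> r" "r < 1"
    using mult_strict_mono[OF less less] unfolding r_def by auto
  have x: "x \<in> A" "adj x = x"
    using a by (simp_all add: x_def A_compose A_adj A_bounded adj_compose adj_in_bounded_ops adj_adj)
  have nx: "norm x \<le> r"
    unfolding x_def r_def using norm_blinfun_compose[of "adj a" a]
    by (simp add: norm_adj A_bounded a)
  \<comment> \<open>Fixed points of \<open>f\<close> solve 2 b = x + b^2. On the self-adjoint
    elements of \<open>A\<close> of norm at most \<open>r\<close>, \<open>f\<close> is a self-map
    because (r + r^2) / 2 \<le> r, and it contracts by the factor \<open>r\<close>. Writing the root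
    of 1 - x as 1 - b keeps \<open>b\<close> in \<open>A\<close>.\<close>
  define s where "s = {b \<in> A. adj b = b \<and> norm b \<le> r}"
  define f where "f b = (1/2) *\<^sub>R (x + (b o\<^sub>L b))" for b
  have "closed s"
    unfolding closed_sequential_limits
  proof (intro allI impI, elim conjE)
    fix X b assume X: "\<forall>n. X n \<in> s" "X \<longlonglongrightarrow> b"
    have b: "b \<in> A"
      using X A_closed unfolding closed_sequential_limits s_def by blast
    have "(\<lambda>n. adj (X n)) \<longlonglongrightarrow> adj b"
      using X b by (intro tendsto_adj) (auto simp: s_def A_bounded)
    then have "adj b = b"
      using X LIMSEQ_unique[of X b "adj b"] by (simp add: s_def)
    moreover have "norm b \<le> r"
      using X by (intro LIMSEQ_le_const2[OF tendsto_norm[OF X(2)]]) (auto simp: s_def)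
    ultimately show "b \<in> s" using b by (simp add: s_def)
  qed
  then have "complete s" by (simp add: complete_eq_closed)
  moreover have "s \<noteq> {}"
    using A_zero r(1) by (auto simp: s_def adj_zero intro: exI[of _ 0])
  moreover have "f ` s \<subseteq> s"
  proof (intro image_subsetI)
    fix b assume "b \<in> s"
    then have b: "b \<in> A" "adj b = b" "norm b \<le> r" by (auto simp: s_def)
    have A: "x + (b o\<^sub>L b) \<in> A" using x b by (simp add: A_add A_compose)
    have "adj (x + (b o\<^sub>L b)) = x + (b o\<^sub>L b)"
      using x b by (simp add: adj_add adj_compose A_bounded A_compose)
    then have "adj (f b) = f b"
      using adj_scale[of "x + (b o\<^sub>L b)" "complex_of_real (1/2)"] A_bounded[OF A]
      unfolding op_scale_of_real f_def complex_cnj_complex_of_real by simp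
    moreover have "norm (f b) \<le> r"
    proof -
      have "norm (b o\<^sub>L b) \<le> norm b * norm b" by (rule norm_blinfun_compose)
      also have "\<dots> \<le> r * 1" using b r by (intro mult_mono) auto
      finally show ?thesis
        using norm_triangle_ineq[of x "b o\<^sub>L b"] nx by (simp add: f_def)
    qed
    ultimately show "f b \<in> s"
      using A_scaleR[OF A] by (simp add: s_def f_def)
  qed
  moreover have "dist (f b) (f c) \<le> r * dist b c" if "b \<in> s" "c \<in> s" for b c
  proof -
    from that have bc: "norm b \<le> r" "norm c \<le> r" by (auto simp: s_def)
    \<comment> \<open>This splitting of b^2 - c^2 is valid without commutativity.\<close>
    have "f b - f c = (1/2) *\<^sub>R ((b o\<^sub>L (b - c)) + ((b - c) o\<^sub>L c))"
      unfolding f_def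
      by (rule blinfun_eqI)
        (simp add: blinfun.add_left blinfun.diff_left blinfun.diff_right blinfun.scaleR_left
          algebra_simps)
    then have "dist (f b) (f c) = 1/2 * norm ((b o\<^sub>L (b - c)) + ((b - c) o\<^sub>L c))"
      by (simp add: dist_norm)
    also have "\<dots> \<le> 1/2 * (norm b * norm (b - c) + norm (b - c) * norm c)"
      by (intro mult_left_mono order_trans[OF norm_triangle_ineq] add_mono norm_blinfun_compose) simp
    also have "\<dots> \<le> 1/2 * (r * norm (b - c) + norm (b - c) * r)"
      using bc by (intro mult_left_mono add_mono mult_right_mono) auto
    finally show "dist (f b) (f c) \<le> r * dist b c" by (simp add: dist_norm)
  qed
  ultimately have "\<exists>!b\<in>s. f b = b"
    using r by (intro Banach_fix)
  then obtain b where "b \<in> s" and fb: "f b = b" by blast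
  then have b: "b \<in> A" "adj b = b" by (auto simp: s_def)
  have "2 *\<^sub>R f b = x + (b o\<^sub>L b)" by (simp add: f_def)
  then have xb: "x = 2 *\<^sub>R b - (b o\<^sub>L b)" unfolding fb by simp
  have "adj (\<phi> a) o\<^sub>L \<phi> a = \<phi> x"
    using a by (simp add: x_def compose adj A_adj)
  also have "\<dots> = 2 *\<^sub>R \<phi> b - (\<phi> b o\<^sub>L \<phi> b)"
    using b unfolding xb by (simp add: diff scaleR compose A_scaleR A_compose)
  finally have \<phi>x: "adj (\<phi> a) o\<^sub>L \<phi> a = 2 *\<^sub>R \<phi> b - (\<phi> b o\<^sub>L \<phi> b)" .
  have \<phi>b: "adj (\<phi> b) = \<phi> b" "\<phi> b \<in> bounded_ops"
    using adj[OF b(1)] b range_bounded by simp_all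
  show ?thesis
  proof (rule norm_blinfun_bound)
    fix \<xi>
    \<comment> \<open>The identity operator enters only here, acting on vectors: self-adjointness of
      \<open>\<phi> b\<close> turns the squared norm of \<open>\<xi> - \<phi> b \<xi>\<close> into
      the quadratic form of (1 - \<phi> b)^2.\<close>
    have "inner (\<phi> b \<xi>) (\<phi> b \<xi>) = inner \<xi> (\<phi> b (\<phi> b \<xi>))"
      using \<phi>b by (simp add: inner_adj_right)
    then have "(norm (\<xi> - \<phi> b \<xi>))\<^sup>2 = inner \<xi> \<xi> - inner \<xi> ((adj (\<phi> a) o\<^sub>L \<phi> a) \<xi>)"
      unfolding power2_norm_eq_inner \<phi>x
      by (simp add: blinfun.diff_left blinfun.scaleR_left inner_diff_left inner_diff_right
          inner_commute)
    then have "(norm (\<phi> a \<xi>))\<^sup>2 \<le> inner \<xi> \<xi>"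
      using norm_apply_square[OF range_bounded[OF a], of \<xi>] zero_le_power2[of "norm (\<xi> - \<phi> b \<xi>)"]
      by linarith
    then have "(norm (\<phi> a \<xi>))\<^sup>2 \<le> (norm \<xi>)\<^sup>2" by (simp add: power2_norm_eq_inner)
    then show "norm (\<phi> a \<xi>) \<le> 1 * norm \<xi>"
      using power2_le_imp_le[OF _ norm_ge_zero] by simp
  qed simp
qed

lemma norm_le:
  assumes a: "a \<in> A"
  shows "norm (\<phi> a) \<le> norm a"
proof (rule dense_ge)
  fix t assume t: "norm a < t"
  then have t0: "0 < t" using norm_ge_zero[of a] by linarith
  have "norm (\<phi> ((1 / t) *\<^sub>R a)) \<le> 1"
    using t t0 by (intro norm_le_one A_scaleR a) simp
  then show "norm (\<phi> a) \<le> t"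
    using t0 by (simp add: scaleR[OF a])
qed

lemma tendsto:
  assumes "X \<longlonglongrightarrow> T" "\<And>n. X n \<in> A" "T \<in> A"
  shows "(\<lambda>n. \<phi> (X n)) \<longlonglongrightarrow> \<phi> T"
proof -
  have "norm (\<phi> (X n) - \<phi> T) \<le> norm (X n - T)" for n
    using norm_le[OF A_diff[OF assms(2,3)], of n] by (simp add: diff assms(2,3))
  moreover have "(\<lambda>n. norm (X n - T)) \<longlonglongrightarrow> 0"
    by (rule tendsto_norm_zero[OF LIM_zero[OF assms(1)]])
  ultimately have "(\<lambda>n. \<phi> (X n) - \<phi> T) \<longlonglongrightarrow> 0"
    by (rule Lim_null_comparison[OF always_eventually[OF allI]])
  then show ?thesis by (rule LIM_zero_cancel)
qed

text \<open>
  With \<open>T = a\<^sup>* a\<close> one has \<open>\<parallel>T\<^sup>k \<xi>\<parallel>\<^sup>2 \<le> \<parallel>T\<^sup>2\<^sup>k \<xi>\<parallel> \<parallel>\<xi>\<parallel>\<close>. For finitely supported \<open>\<xi>\<close> the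
  hypothesis bounds \<open>\<parallel>T\<^sup>k \<xi>\<parallel>\<close> by a multiple of \<open>\<parallel>\<phi> T\<parallel>\<^sup>k\<close>, and the multiplicative constant
  disappears when \<open>k\<close> runs through the powers of two.
\<close>

lemma norm_le_norm_image:
  assumes ket_le: "\<And>S x. S \<in> A \<Longrightarrow> x \<in> K \<Longrightarrow> norm (S (ket x)) \<le> norm (\<phi> S)"
    and a: "a \<in> A" and vanish: "\<And>x. x \<notin> K \<Longrightarrow> a (ket x) = 0"
  shows "norm a \<le> norm (\<phi> a)"
proof -
  define T where "T = adj a o\<^sub>L a"
  \<comment> \<open>The power of \<open>T\<close> with exponent 2^n. Under squaring,
    self-adjointness, vanishing outside \<open>K\<close> and the norm bound all pass to the next
    step.\<close>
  define S where "S n = ((\<lambda>R. R o\<^sub>L R) ^^ n) T" for n :: nat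
  define M where "M = (norm (\<phi> a))\<^sup>2"
  have S0: "S 0 = T" and SSuc: "S (Suc n) = S n o\<^sub>L S n" for n by (simp_all add: S_def)
  have S: "S n \<in> A \<and> adj (S n) = S n \<and> (\<forall>x. x \<notin> K \<longrightarrow> S n (ket x) = 0) \<and>
    norm (\<phi> (S n)) \<le> M ^ (2 ^ n)" for n
  proof (induction n)
    case 0
    have "norm (\<phi> T) \<le> M"
      using norm_blinfun_compose[of "adj (\<phi> a)" "\<phi> a"] a
      by (simp add: T_def M_def compose adj A_adj norm_adj range_bounded power2_eq_square)
    then show ?case
      using a vanish by (simp add: S0 T_def A_compose A_adj A_bounded adj_compose
          adj_in_bounded_ops adj_adj blinfun.zero_right)
  next
    case (Suc n)
    have "norm (\<phi> (S (Suc n))) \<le> norm (\<phi> (S n)) * norm (\<phi> (S n))"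
      using norm_blinfun_compose Suc by (simp add: SSuc compose)
    also have "\<dots> \<le> M ^ (2 ^ n) * M ^ (2 ^ n)"
      using Suc by (intro mult_mono) (auto simp: M_def)
    finally have "norm (\<phi> (S (Suc n))) \<le> M ^ (2 ^ Suc n)"
      by (simp add: mult_2 power_add)
    then show ?case
      using Suc by (simp add: SSuc A_compose A_bounded adj_compose blinfun.zero_right)
  qed
  have ket_S: "norm (S n (ket x)) \<le> M ^ (2 ^ n)" for n x
  proof (cases "x \<in> K")
    case True
    then show ?thesis using ket_le[of "S n" x] S[of n] by linarith
  next
    case False
    then show ?thesis using S[of n] by (simp add: M_def)
  qed
  have fin: "norm (a \<xi>) \<le> norm (\<phi> a) * norm \<xi>"
    if \<xi>: "\<xi> = (\<Sum>x\<in>F. c x *\<^sub>C ket x)" for \<xi> F c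
  proof (cases "\<xi> = 0")
    case False
    \<comment> \<open>\<open>C\<close> depends on the finitely supported \<xi> but not on
      \<open>n\<close>, which is what allows \<open>power_two_power_bound\<close> to discard
      it.\<close>
    define C where "C = (\<Sum>x\<in>F. cmod (c x)) / norm \<xi>"
    define v where "v n = norm (S n \<xi>) / norm \<xi>" for n
    have "norm (S n \<xi>) \<le> (\<Sum>x\<in>F. cmod (c x) * M ^ (2 ^ n))" for n
      unfolding \<xi> blinfun.sum_right
    proof (rule sum_norm_le)
      show "norm (S n (c x *\<^sub>C ket x)) \<le> cmod (c x) * M ^ (2 ^ n)" for x
        using S[of n] ket_S[of n x]
        by (simp add: bounded_opsD A_bounded norm_cscale mult_left_mono)
    qed
    then have vC: "v n \<le> C * M ^ (2 ^ n)" for n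
      using False by (simp add: v_def C_def divide_right_mono sum_distrib_right)
    have v: "(v n)\<^sup>2 \<le> v (Suc n)" for n
    proof -
      have "(norm (S n \<xi>))\<^sup>2 = inner \<xi> (S (Suc n) \<xi>)"
        using norm_apply_square[of "S n" \<xi>] S[of n] by (simp add: SSuc A_bounded)
      also have "\<dots> \<le> norm \<xi> * norm (S (Suc n) \<xi>)" by (rule norm_cauchy_schwarz)
      finally have "(norm (S n \<xi>))\<^sup>2 / (norm \<xi>)\<^sup>2 \<le> norm \<xi> * norm (S (Suc n) \<xi>) / (norm \<xi>)\<^sup>2"
        by (rule divide_right_mono) simp
      then show ?thesis
        using False by (simp add: v_def power_divide power2_eq_square)
    qed
    have "v 0 ^ (2 ^ n) \<le> v n" for n
    proof (induction n)
      case (Suc n)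
      have "v 0 ^ (2 ^ Suc n) = (v 0 ^ (2 ^ n))\<^sup>2"
        by (metis power_Suc2 power_mult)
      also have "\<dots> \<le> (v n)\<^sup>2"
        using Suc by (rule power_mono) (simp add: v_def)
      finally show ?case using v[of n] by linarith
    qed simp
    then have "v 0 ^ (2 ^ n) \<le> C * M ^ (2 ^ n)" for n
      using vC[of n] by (rule order_trans)
    then have "v 0 \<le> M"
      by (rule power_two_power_bound[rotated]) (simp add: M_def)
    then have T\<xi>: "norm (T \<xi>) \<le> M * norm \<xi>"
      using False by (simp add: v_def S0 divide_le_eq)
    have "(norm (a \<xi>))\<^sup>2 = inner \<xi> (T \<xi>)"
      unfolding T_def by (rule norm_apply_square[OF A_bounded[OF a]])
    also have "\<dots> \<le> norm \<xi> * (M * norm \<xi>)"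
      by (rule order_trans[OF norm_cauchy_schwarz mult_left_mono[OF T\<xi> norm_ge_zero]])
    also have "\<dots> = (norm (\<phi> a) * norm \<xi>)\<^sup>2"
      by (simp add: M_def power2_eq_square)
    finally show ?thesis
      by (rule power2_le_imp_le) simp
  qed simp
  show ?thesis
  proof (rule norm_blinfun_bound)
    fix \<xi> :: "'x ell2"
    have "norm (a \<xi>) - norm (\<phi> a) * norm \<xi> \<le> 0 + e" if "e > 0" for e
    proof -
      \<comment> \<open>Replacing \<xi> by a finitely supported vector costs a factor
        \<open>norm a\<close> on the left and \<open>norm (\<phi> a)\<close> on the right.\<close>
      define L where "L = norm a + norm (\<phi> a) + 1"
      have L: "L > 0" unfolding L_def by (simp add: add_nonneg_pos)
      obtain F where F: "norm (\<xi> - (\<Sum>x\<in>F. coeff \<xi> x *\<^sub>C ket x)) < e / L"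
        using ket_approx[OF divide_pos_pos[OF \<open>e > 0\<close> L]] by metis
      define \<zeta> where "\<zeta> = (\<Sum>x\<in>F. coeff \<xi> x *\<^sub>C ket x)"
      have "norm (a \<xi>) \<le> norm (a (\<xi> - \<zeta>)) + norm (a \<zeta>)"
        using norm_triangle_ineq[of "a (\<xi> - \<zeta>)" "a \<zeta>"] by (simp add: blinfun.diff_right)
      also have "\<dots> \<le> norm a * norm (\<xi> - \<zeta>) + norm (\<phi> a) * norm \<zeta>"
        using fin[OF \<zeta>_def] norm_blinfun by (intro add_mono)
      also have "\<dots> \<le> norm a * norm (\<xi> - \<zeta>) + norm (\<phi> a) * (norm \<xi> + norm (\<xi> - \<zeta>))"
        using norm_triangle_ineq4[of \<xi> "\<xi> - \<zeta>"] by (intro add_left_mono mult_left_mono) simp_all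
      also have "\<dots> \<le> L * norm (\<xi> - \<zeta>) + norm (\<phi> a) * norm \<xi>"
        by (simp add: L_def algebra_simps)
      also have "L * norm (\<xi> - \<zeta>) \<le> L * (e / L)"
        using F L unfolding \<zeta>_def by (intro mult_left_mono) simp_all
      finally show ?thesis using L by simp
    qed
    then have "norm (a \<xi>) - norm (\<phi> a) * norm \<xi> \<le> 0"
      by (rule field_le_epsilon)
    then show "norm (a \<xi>) \<le> norm (\<phi> a) * norm \<xi>" by simp
  qed simp
qed

text \<open>\<open>B\<close> acts as a set of representatives modulo the kernel on which
  \<open>\<phi>\<close> is bounded below. As \<open>B\<close> is closed under differences, a
  convergent sequence of values lifts to a Cauchy sequence in \<open>B\<close>, and its limit in
  \<open>A\<close> is mapped to the limit of the values.\<close>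

lemma cstar_subalgebra_image:
  assumes B: "B \<subseteq> A" "\<And>a b. a \<in> B \<Longrightarrow> b \<in> B \<Longrightarrow> a - b \<in> B"
    and onto: "\<And>a. a \<in> A \<Longrightarrow> \<exists>b\<in>B. \<phi> b = \<phi> a"
    and bound: "\<And>b. b \<in> B \<Longrightarrow> norm b \<le> norm (\<phi> b)"
  shows "cstar_subalgebra (\<phi> ` A)"
proof -
  have "closed (\<phi> ` A)"
    unfolding closed_sequential_limits
  proof (intro allI impI, elim conjE)
    fix X T assume X: "\<forall>n. X n \<in> \<phi> ` A" "X \<longlonglongrightarrow> T"
    have "\<exists>b\<in>B. X n = \<phi> b" for n using X(1) onto by (metis imageE)
    then obtain b where b: "\<And>n. b n \<in> B" "\<And>n. X n = \<phi> (b n)" by metis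
    have d: "norm (b m - b n) \<le> norm (X m - X n)" for m n
      using bound[OF B(2)[OF b(1) b(1)], of m n] b B(1) by (simp add: diff subset_eq)
    have "Cauchy b"
    proof (rule CauchyI)
      fix e :: real assume "0 < e"
      then obtain M where "\<And>m n. m \<ge> M \<Longrightarrow> n \<ge> M \<Longrightarrow> norm (X m - X n) < e"
        using CauchyD[OF LIMSEQ_imp_Cauchy[OF X(2)]] by blast
      then show "\<exists>M. \<forall>m\<ge>M. \<forall>n\<ge>M. norm (b m - b n) < e"
        using d by (meson le_less_trans)
    qed
    then obtain a where a: "b \<longlonglongrightarrow> a"
      by (auto simp: Cauchy_convergent_iff convergent_def)
    have bA: "b n \<in> A" for n using b(1) B(1) by blast
    then have "a \<in> A"
      using A_closed a unfolding closed_sequential_limits by blast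
    then have "(\<lambda>n. \<phi> (b n)) \<longlonglongrightarrow> \<phi> a"
      by (intro tendsto a bA)
    then have "T = \<phi> a" using X(2) b(2) by (metis LIMSEQ_unique ext)
    with \<open>a \<in> A\<close> show "T \<in> \<phi> ` A" by blast
  qed
  moreover have "0 \<in> \<phi> ` A" using A_zero zero by (metis imageI)
  ultimately show ?thesis
    unfolding cstar_subalgebra_def
    by (auto simp: range_bounded add[symmetric] scale[symmetric] compose[symmetric] adj[symmetric]
        A_add A_scale A_compose A_adj)
qed

end

section \<open>Constructible right ideals and partial identities\<close>

lemma map_eqI: "(\<And>x y. f x = Some y \<longleftrightarrow> g x = Some y) \<Longrightarrow> f = g"
  by (metis ext not_Some_eq)

text \<open>For X in \<open>J\<close> these are exactly the idempotents of the hull, by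
  \<open>idempotent_map_iff\<close>, \<open>dom_in_J\<close> and
  \<open>partial_id_J\<close>.\<close>

definition partial_id :: "'a set \<Rightarrow> 'a \<Rightarrow> 'a option" where
  "partial_id X x = (if x \<in> X then Some x else None)"

lemma partial_id_eq_Some_iff: "partial_id X x = Some y \<longleftrightarrow> x \<in> X \<and> y = x"
  by (auto simp: partial_id_def)

lemma dom_partial_id: "dom (partial_id X) = X"
  by (auto simp: partial_id_def dom_def)

lemma ran_partial_id: "ran (partial_id X) = X"
  by (auto simp: partial_id_def ran_def)

lemma partial_id_Int: "partial_id (X \<inter> Y) = partial_id X \<circ>\<^sub>m partial_id Y"
  by (rule map_eqI) (auto simp: map_comp_eq_Some_iff partial_id_eq_Some_iff)

lemma idempotent_map_iff:
  assumes "inj_on f (dom f)"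
  shows "f \<circ>\<^sub>m f = f \<longleftrightarrow> f = partial_id (dom f)"
proof
  assume *: "f \<circ>\<^sub>m f = f"
  have "y = x" if "f x = Some y" for x y
  proof -
    have "(f \<circ>\<^sub>m f) x = Some y" using that * by simp
    then have "f y = Some y" using that by (auto simp: map_comp_eq_Some_iff)
    then show "y = x" using that assms unfolding inj_on_dom_iff by blast
  qed
  then show "f = partial_id (dom f)"
    by (intro map_eqI) (auto simp: partial_id_eq_Some_iff)
next
  assume "f = partial_id (dom f)"
  then show "f \<circ>\<^sub>m f = f"
    using partial_id_Int[of "dom f" "dom f"] by simp
qed

lemma ideal_word_Nil: "ideal_word [] = UNIV"
  and ideal_word_Cons: "ideal_word ((t, s) # w) = {r. t * r \<in> (\<lambda>x. s * x) ` ideal_word w}"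
  by (simp_all add: ideal_word_def)

lemma left_mult_hull: "left_mult s \<in> left_inverse_hull"
  and comp_hull: "f \<in> left_inverse_hull \<Longrightarrow> g \<in> left_inverse_hull \<Longrightarrow> f \<circ>\<^sub>m g \<in> left_inverse_hull"
  and partial_inverse_hull: "f \<in> left_inverse_hull \<Longrightarrow> partial_inverse f \<in> left_inverse_hull"
  by (rule left_inverse_hull.intros; assumption)+

text \<open>Preimages and images are treated together because \<open>partial_inverse\<close>
  exchanges them. A generator prepends one letter with 1 in its idle slot. Nonempty words are
  tracked because \<open>J\<close> is built from these.\<close>

lemma hull_transports_ideal_words:
  "f \<in> left_inverse_hull \<Longrightarrow>
    (\<exists>w'. w' \<noteq> [] \<and> {x. \<exists>y\<in>ideal_word w. f x = Some y} = ideal_word w') \<and>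
    (\<exists>w'. w' \<noteq> [] \<and> {y. \<exists>x\<in>ideal_word w. f x = Some y} = ideal_word w')"
proof (induction arbitrary: w rule: left_inverse_hull.induct)
  case (1 s)
  have "{x. \<exists>y\<in>ideal_word w. left_mult s x = Some y} = ideal_word ((s, 1) # w)"
    by (auto simp: ideal_word_Cons left_mult_def)
  moreover have "{y. \<exists>x\<in>ideal_word w. left_mult s x = Some y} = ideal_word ((1, s) # w)"
    by (auto simp: ideal_word_Cons left_mult_def)
  ultimately show ?case by blast
next
  case (2 f g)
  obtain u where u: "{x. \<exists>y\<in>ideal_word w. f x = Some y} = ideal_word u"
    using "2.IH"(1)[of w] by blast
  obtain u' where u': "u' \<noteq> []" "{x. \<exists>y\<in>ideal_word u. g x = Some y} = ideal_word u'"
    using "2.IH"(2)[of u] by blast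
  obtain v where v: "{y. \<exists>x\<in>ideal_word w. g x = Some y} = ideal_word v"
    using "2.IH"(2)[of w] by blast
  obtain v' where v': "v' \<noteq> []" "{y. \<exists>x\<in>ideal_word v. f x = Some y} = ideal_word v'"
    using "2.IH"(1)[of v] by blast
  have "{x. \<exists>y\<in>ideal_word w. (f \<circ>\<^sub>m g) x = Some y} = ideal_word u'"
    unfolding u'(2)[symmetric] u[symmetric] map_comp_eq_Some_iff by blast
  moreover have "{y. \<exists>x\<in>ideal_word w. (f \<circ>\<^sub>m g) x = Some y} = ideal_word v'"
    unfolding v'(2)[symmetric] v[symmetric] map_comp_eq_Some_iff by blast
  ultimately show ?case using u' v' by blast
next
  case (3 f)
  show ?case
    unfolding partial_inverse_iff[OF inj_left_inverse_hull[OF 3(1)]] using 3(2)[of w] by blast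
qed

lemma partial_id_ideal_word: "partial_id (ideal_word w) \<in> left_inverse_hull"
proof (induction w)
  case Nil
  have "partial_id (ideal_word []) = left_mult (1 :: 'a)"
    by (simp add: fun_eq_iff partial_id_def ideal_word_Nil left_mult_def)
  then show ?case by (simp add: left_mult_hull)
next
  case (Cons ts w)
  obtain t s where ts: "ts = (t, s)" by fastforce
  have left_mult_iff: "left_mult r x = Some y \<longleftrightarrow> r * x = y" for r x y :: 'a
    by (simp add: left_mult_def)
  have inverse_iff: "partial_inverse (left_mult r) y = Some x \<longleftrightarrow> r * x = y" for r x y :: 'a
    by (simp add: partial_inverse_iff[OF inj_left_inverse_hull[OF left_mult_hull]] left_mult_iff)
  \<comment> \<open>Conjugation by t^-1 s carries the partial identity on X to the one on t^-1 s
    X.\<close>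
  have "partial_id (ideal_word (ts # w)) = partial_inverse (left_mult t) \<circ>\<^sub>m (left_mult s \<circ>\<^sub>m
    (partial_id (ideal_word w) \<circ>\<^sub>m (partial_inverse (left_mult s) \<circ>\<^sub>m left_mult t)))"
    unfolding ts
    by (rule map_eqI)
      (auto simp: map_comp_eq_Some_iff inverse_iff left_mult_iff partial_id_eq_Some_iff
        ideal_word_Cons dest: left_cancel intro: rev_image_eqI[OF _ sym])
  then show ?case
    by (simp add: comp_hull left_mult_hull partial_inverse_hull Cons)
qed

lemma partial_id_J: "X \<in> J \<Longrightarrow> partial_id X \<in> left_inverse_hull"
proof -
  have "partial_id (\<Inter>F) \<in> left_inverse_hull"
    if "finite F" "F \<noteq> {}" "F \<subseteq> {ideal_word w | w :: ('a \<times> 'a) list. w \<noteq> []}" for F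
    using that
  proof (induction F rule: finite_ne_induct)
    case (singleton X)
    then show ?case using partial_id_ideal_word by auto
  next
    case (insert X F)
    then have "partial_id X \<in> left_inverse_hull" using partial_id_ideal_word by auto
    with insert show ?case by (simp add: partial_id_Int comp_hull)
  qed
  then show "X \<in> J \<Longrightarrow> partial_id X \<in> left_inverse_hull" by (auto simp: J_def)
qed

lemma dom_in_J:
  assumes "f \<in> left_inverse_hull"
  shows "dom f \<in> J"
proof -
  obtain w where "w \<noteq> []" "{x. \<exists>y\<in>ideal_word []. f x = Some y} = ideal_word w"
    using hull_transports_ideal_words[OF assms, of "[]"] by blast
  then have "dom f = \<Inter>{ideal_word w}" "w \<noteq> []"
    by (auto simp: ideal_word_Nil dom_def)
  then show ?thesis unfolding J_def by blast
qed

text \<open>An intersection is the domain of a composite of partial identities, so closure of the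
  hull under composition gives the claim.\<close>

lemma J_Int: "X \<in> J \<Longrightarrow> Y \<in> J \<Longrightarrow> X \<inter> Y \<in> J"
  using dom_in_J[OF comp_hull[OF partial_id_J partial_id_J]]
  by (metis dom_partial_id partial_id_Int)

section \<open>The reduced algebra of the left inverse hull\<close>

lemma pmap_times: "pmap (p * q) = pmap p \<circ>\<^sub>m pmap q"
  by (rule times_Il.rep_eq)

lemma pmap_inj: "inj_on (pmap p) (dom (pmap p))"
  by (rule inj_left_inverse_hull[OF pmap])

lemma pmap_adjoint_iff: "pmap (p\<^sup>\<star>) x = Some y \<longleftrightarrow> pmap p y = Some x"
  by (simp add: adjoint_elem_Il.rep_eq partial_inverse_iff pmap_inj)

lemma pmap_Abs_partial_id: "X \<in> J \<Longrightarrow> pmap (Abs_Il (partial_id X)) = partial_id X"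
  by (simp add: Abs_Il_inverse partial_id_J)

text \<open>\<open>p\<^sup>\<star> * p\<close> is the partial identity on the domain of
  \<open>p\<close>, so it fixes \<open>q\<close> exactly when all values of \<open>q\<close> lie
  there. The condition in \<open>Lam\<close> thereby becomes an inclusion of subsets of S.\<close>

lemma initial_projection_iff:
  "p\<^sup>\<star> * p * q = q \<longleftrightarrow> ran (pmap q) \<subseteq> dom (pmap p)" for p q :: "'a::left_cancel_monoid Il"
proof -
  have *: "pmap (p\<^sup>\<star> * p * q) x = Some y \<longleftrightarrow> pmap q x = Some y \<and> y \<in> dom (pmap p)" for x y
  proof
    assume "pmap (p\<^sup>\<star> * p * q) x = Some y"
    then obtain z w where "pmap q x = Some z" "pmap p z = Some w" "pmap p y = Some w"
      by (auto simp: pmap_times map_comp_eq_Some_iff pmap_adjoint_iff)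
    moreover from this have "z = y" using pmap_inj[of p] unfolding inj_on_dom_iff by blast
    ultimately show "pmap q x = Some y \<and> y \<in> dom (pmap p)" by blast
  qed (auto simp: pmap_times map_comp_eq_Some_iff pmap_adjoint_iff)
  show ?thesis
  proof
    assume "p\<^sup>\<star> * p * q = q"
    then show "ran (pmap q) \<subseteq> dom (pmap p)" using * by (auto simp: ran_def)
  next
    assume "ran (pmap q) \<subseteq> dom (pmap p)"
    then have "pmap (p\<^sup>\<star> * p * q) = pmap q"
      by (intro map_eqI) (auto simp: * ran_def)
    then show "p\<^sup>\<star> * p * q = q" by (simp add: pmap_inject)
  qed
qed

lemma Lam_ket_Il:
  "Lam p (ket q) = (if ran (pmap q) \<subseteq> dom (pmap p) then ket (p * q) else 0)"
  by (simp add: Lam_ket initial_projection_iff)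

lemma Lam_inj:
  fixes p :: "'p::inverse_semigroup"
  defines "f \<equiv> \<lambda>q. if p\<^sup>\<star> * p * q = q then Some (p * q) else None"
  shows "inj_on f (dom f)"
  unfolding f_def by (auto simp: inj_on_def dom_def split: if_splits) (metis mult.assoc)

lemma Lam_bounded: "Lam p \<in> bounded_ops"
  unfolding Lam_def by (rule basis_op[OF Lam_inj])

lemma adjoint_adjoint: "(p\<^sup>\<star>)\<^sup>\<star> = p" for p :: "'p::inverse_semigroup"
  by (rule adjoint_unique[OF adjoint_mult_adjoint mult_adjoint_mult, symmetric])

text \<open>Left multiplication by \<open>p\<close> maps the elements fixed by its initial
  projection bijectively onto those fixed by its final projection, and left multiplication by
  \<open>p\<^sup>\<star>\<close> inverts it.\<close>

lemma adj_Lam: "adj (Lam p) = Lam (p\<^sup>\<star>)"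
  unfolding Lam_def adj_basis_op[OF Lam_inj]
proof (rule arg_cong[where f = basis_op], rule map_eqI)
  fix q r :: 'a
  have "p\<^sup>\<star> * p * r = r \<and> p * r = q \<longleftrightarrow> p * p\<^sup>\<star> * q = q \<and> p\<^sup>\<star> * q = r"
    by (metis mult.assoc)
  then show "(partial_inverse (\<lambda>q. if p\<^sup>\<star> * p * q = q then Some (p * q) else None) q = Some r) =
    ((if (p\<^sup>\<star>)\<^sup>\<star> * p\<^sup>\<star> * q = q then Some (p\<^sup>\<star> * q) else None) = Some r)"
    unfolding partial_inverse_iff[OF Lam_inj] adjoint_adjoint by (simp split: if_split) blast
qed

lemma Lam_compose: "Lam p o\<^sub>L Lam q = Lam (p * q)" for p q :: "'a::left_cancel_monoid Il"
proof (rule bounded_ops_eqI)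
  fix r :: "'a Il"
  have "ran (pmap r) \<subseteq> dom (pmap q) \<and> ran (pmap (q * r)) \<subseteq> dom (pmap p) \<longleftrightarrow>
    ran (pmap r) \<subseteq> dom (pmap (p * q))"
  proof -
    have sub: "ran (pmap s) \<subseteq> dom (pmap t) \<longleftrightarrow>
      (\<forall>x y. pmap s x = Some y \<longrightarrow> (\<exists>z. pmap t y = Some z))" for s t :: "'a Il"
      by (auto simp: ran_def)
    show ?thesis
    proof
      assume *: "ran (pmap r) \<subseteq> dom (pmap q) \<and> ran (pmap (q * r)) \<subseteq> dom (pmap p)"
      show "ran (pmap r) \<subseteq> dom (pmap (p * q))"
        unfolding sub
      proof (intro allI impI)
        fix x y assume r: "pmap r x = Some y"
        then obtain z where z: "pmap q y = Some z" using * unfolding sub by blast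
        then have "pmap (q * r) x = Some z" using r by (simp add: pmap_times)
        then obtain w where "pmap p z = Some w" using * unfolding sub by blast
        with z show "\<exists>w. pmap (p * q) y = Some w" by (simp add: pmap_times)
      qed
    next
      assume *: "ran (pmap r) \<subseteq> dom (pmap (p * q))"
      have pq: "\<exists>z w. pmap q y = Some z \<and> pmap p z = Some w" if "pmap r x = Some y" for x y
      proof -
        have "\<exists>w. pmap (p * q) y = Some w" using * that unfolding sub by blast
        then show ?thesis unfolding pmap_times map_comp_eq_Some_iff by blast
      qed
      show "ran (pmap r) \<subseteq> dom (pmap q) \<and> ran (pmap (q * r)) \<subseteq> dom (pmap p)"
        unfolding sub
      proof (intro conjI allI impI)
        show "\<exists>z. pmap q y = Some z" if "pmap r x = Some y" for x y using pq[OF that] by blast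
        show "\<exists>w. pmap p z = Some w" if "pmap (q * r) x = Some z" for x z
          using that pq[of x] by (auto simp: pmap_times map_comp_eq_Some_iff)
      qed
    qed
  qed
  then show "(Lam p o\<^sub>L Lam q) (ket r) = Lam (p * q) (ket r)"
    by (simp add: Lam_ket_Il mult.assoc blinfun.zero_right) blast
qed (simp_all add: bounded_ops_closed_operations Lam_bounded)

lemma compose_op_scale_left: "op_scale c S o\<^sub>L T = op_scale c (S o\<^sub>L T)"
  by (rule blinfun_eqI) (simp add: op_scale_apply)

lemma compose_op_scale_right: "S \<in> bounded_ops \<Longrightarrow> S o\<^sub>L op_scale c T = op_scale c (S o\<^sub>L T)"
  by (rule blinfun_eqI) (simp add: op_scale_apply bounded_opsD)

lemmas compose_add_left = bounded_bilinear.add_left[OF bounded_bilinear_blinfun_compose]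
  and compose_add_right = bounded_bilinear.add_right[OF bounded_bilinear_blinfun_compose]
  and compose_zero_left = bounded_bilinear.zero_left[OF bounded_bilinear_blinfun_compose]
  and compose_zero_right = bounded_bilinear.zero_right[OF bounded_bilinear_blinfun_compose]

text \<open>Products and adjoints of operators \<open>Lam p\<close> are again of this form, so their
  span is already a star-algebra.\<close>

lemma cstar_subalgebra_reduced:
  "cstar_subalgebra (reduced_inverse_cstar :: 'a::left_cancel_monoid Il op set)"
proof -
  let ?D = "complex_op.span (range (Lam :: 'a Il \<Rightarrow> _))"
  have bounded: "T \<in> bounded_ops" if "T \<in> ?D" for T
    using that by (induction rule: complex_op.span_induct_alt)
      (auto simp: bounded_ops_closed_operations Lam_bounded)
  have Lam_D: "Lam p \<in> ?D" for p by (rule complex_op.span_base) simp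
  have Lam_comp: "Lam p o\<^sub>L T \<in> ?D" if "T \<in> ?D" for p T
    using that
    by (induction rule: complex_op.span_induct_alt)
      (auto simp: compose_add_right compose_zero_right compose_op_scale_right
        Lam_bounded Lam_compose
        intro!: complex_op.span_add complex_op.span_scale complex_op.span_zero Lam_D)
  have comp: "S o\<^sub>L T \<in> ?D" if "S \<in> ?D" "T \<in> ?D" for S T
    using that(1)
    by (induction rule: complex_op.span_induct_alt)
      (auto simp: compose_add_left compose_zero_left compose_op_scale_left
        intro!: complex_op.span_add complex_op.span_scale complex_op.span_zero Lam_comp that(2))
  have adj: "T \<in> bounded_ops \<and> adj T \<in> ?D" if "T \<in> ?D" for T
    using that
    by (induction rule: complex_op.span_induct_alt)
      (auto simp: adj_zero adj_add adj_scale adj_Lam bounded_ops_closed_operations Lam_bounded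
        intro!: complex_op.span_add complex_op.span_scale complex_op.span_zero Lam_D)
  show ?thesis
    unfolding reduced_inverse_cstar_def
    by (rule cstar_subalgebra_closure)
      (use bounded adj comp in \<open>auto intro: complex_op.span_add complex_op.span_scale complex_op.span_zero\<close>)
qed

lemma Lam_in_reduced: "Lam p \<in> reduced_inverse_cstar"
  unfolding reduced_inverse_cstar_def
  by (intro subsetD[OF closure_subset] complex_op.span_base) simp

section \<open>Diagonal coefficients under E*-unitarity\<close>

lemma hull_right_equivariant:
  "f \<in> left_inverse_hull \<Longrightarrow> f s = Some t \<Longrightarrow> f (s * r) = Some (t * r)"
proof (induction arbitrary: s t rule: left_inverse_hull.induct)
  case (3 f)
  then show ?case by (simp add: partial_inverse_iff inj_left_inverse_hull)
qed (auto simp: left_mult_def mult.assoc map_comp_eq_Some_iff)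

lemma omega_bounded: "omega f \<in> bounded_ops"
  unfolding omega_def by (rule basis_op[OF pmap_inj])

context
  assumes unitary: "E_star_unitary (left_inverse_hull :: ('a::left_cancel_monoid \<Rightarrow> 'a option) set)"
begin

text \<open>If f fixes s then, by right equivariance, it fixes sS pointwise, that is, it fixes the
  nonzero element \<open>left_mult s\<close> under composition. E*-unitarity then makes f
  idempotent, so a non-idempotent f has no fixed point and zero diagonal.\<close>

lemma omega_diagonal:
  fixes f :: "'a Il"
  shows "coeff (omega f (ket s)) s =
    (if pmap f \<circ>\<^sub>m pmap f = pmap f \<and> s \<in> dom (pmap f) then 1 else 0)"
proof -
  have "pmap f s = Some s \<longleftrightarrow> pmap f \<circ>\<^sub>m pmap f = pmap f \<and> s \<in> dom (pmap f)"
  proof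
    assume s: "pmap f s = Some s"
    have "pmap f \<circ>\<^sub>m left_mult s = left_mult s"
      using hull_right_equivariant[OF pmap s]
      by (simp add: fun_eq_iff left_mult_def map_comp_def)
    moreover have "left_mult s \<noteq> Map.empty"
      by (simp add: fun_eq_iff left_mult_def)
    ultimately have "pmap f \<circ>\<^sub>m pmap f = pmap f"
      using unitary pmap[of f] left_mult_hull[of s] unfolding E_star_unitary_def by blast
    with s show "pmap f \<circ>\<^sub>m pmap f = pmap f \<and> s \<in> dom (pmap f)" by blast
  next
    assume "pmap f \<circ>\<^sub>m pmap f = pmap f \<and> s \<in> dom (pmap f)"
    then have "pmap f = partial_id (dom (pmap f))" "s \<in> dom (pmap f)"
      by (simp_all add: idempotent_map_iff[OF pmap_inj])
    then show "pmap f s = Some s" by (metis partial_id_def)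
  qed
  moreover have "coeff (omega f (ket s)) s = (if pmap f s = Some s then 1 else 0)"
    by (auto simp: omega_ket coeff_simps split: option.split)
  ultimately show ?thesis by simp
qed

text \<open>The formula of \<open>omega_diagonal\<close> with the point s replaced by the set ran q,
  membership in the domain becoming inclusion. E*-unitarity is applied to q itself, hence the
  exclusion of the empty map.\<close>

lemma Lam_diagonal:
  fixes f q :: "'a Il"
  assumes q: "pmap q \<noteq> Map.empty"
  shows "coeff (Lam f (ket q)) q =
    (if pmap f \<circ>\<^sub>m pmap f = pmap f \<and> ran (pmap q) \<subseteq> dom (pmap f) then 1 else 0)"
proof (cases "ran (pmap q) \<subseteq> dom (pmap f)")
  case True
  have "q = f * q \<longleftrightarrow> pmap f \<circ>\<^sub>m pmap f = pmap f"
  proof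
    assume "q = f * q"
    then have "pmap f \<circ>\<^sub>m pmap q = pmap q" by (metis pmap_times)
    then show "pmap f \<circ>\<^sub>m pmap f = pmap f"
      using unitary pmap[of f] pmap[of q] q unfolding E_star_unitary_def by blast
  next
    assume "pmap f \<circ>\<^sub>m pmap f = pmap f"
    then have "pmap f = partial_id (dom (pmap f))"
      by (simp add: idempotent_map_iff[OF pmap_inj])
    then have "pmap f y = Some z \<longleftrightarrow> y \<in> dom (pmap f) \<and> z = y" for y z
      by (metis partial_id_eq_Some_iff)
    with True have "pmap q = pmap (f * q)"
      by (intro map_eqI) (auto simp: pmap_times map_comp_eq_Some_iff ran_def)
    then show "q = f * q" by (simp add: pmap_inject)
  qed
  with True show ?thesis by (simp add: Lam_ket_Il coeff_simps)
qed (simp add: Lam_ket_Il coeff_simps)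

end

locale hull_rep = star_rep "reduced_inverse_cstar :: 'a Il op set" \<phi>
  for \<phi> :: "'a::left_cancel_monoid Il op \<Rightarrow> 'a op" +
  assumes Lam: "\<phi> (Lam f) = omega f"
begin

lemma span_in_reduced: "y \<in> complex_op.span (range Lam) \<Longrightarrow> y \<in> reduced_inverse_cstar"
  unfolding reduced_inverse_cstar_def using closure_subset by blast

text \<open>\<open>G\<close> collects the finitely many f occurring in y. It is chosen before q and
  s, so one finite set of membership conditions decides the comparison for every q.\<close>

lemma diagonal_eq:
  assumes unitary: "E_star_unitary (left_inverse_hull :: ('a \<Rightarrow> 'a option) set)"
    and y: "y \<in> complex_op.span (range Lam)"
  shows "\<exists>G. finite G \<and> (\<forall>q s. pmap q \<noteq> Map.empty \<longrightarrow>
    (\<forall>f\<in>G. s \<in> dom (pmap f) \<longleftrightarrow> ran (pmap q) \<subseteq> dom (pmap f)) \<longrightarrow>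
    coeff (y (ket q)) q = coeff (\<phi> y (ket s)) s)"
proof -
  \<comment> \<open>Membership is carried through the induction because additivity of
    \<open>\<phi>\<close> is known only on the algebra.\<close>
  have "y \<in> reduced_inverse_cstar \<and> ?thesis"
    using y
  proof (induction rule: complex_op.span_induct_alt)
    case base
    then show ?case by (auto simp: A_zero zero zero_ell2.rep_eq intro: exI[of _ "{}"])
  next
    case (step c x y)
    then obtain f G where x: "x = Lam f" and y: "y \<in> reduced_inverse_cstar" and G: "finite G"
      "\<And>q s. pmap q \<noteq> Map.empty \<Longrightarrow>
        \<forall>f\<in>G. s \<in> dom (pmap f) \<longleftrightarrow> ran (pmap q) \<subseteq> dom (pmap f) \<Longrightarrow>
        coeff (y (ket q)) q = coeff (\<phi> y (ket s)) s"
      by blast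
    have "coeff ((op_scale c x + y) (ket q)) q = coeff (\<phi> (op_scale c x + y) (ket s)) s"
      if "pmap q \<noteq> Map.empty"
        "\<forall>f\<in>insert f G. s \<in> dom (pmap f) \<longleftrightarrow> ran (pmap q) \<subseteq> dom (pmap f)" for q s
    proof -
      have "coeff (Lam f (ket q)) q = coeff (omega f (ket s)) s"
        using that by (simp add: omega_diagonal[OF unitary] Lam_diagonal[OF unitary])
      with that G(2)[of q s] show ?thesis
        by (simp add: x y add scale Lam Lam_in_reduced A_scale blinfun.add_left op_scale_apply
            coeff_simps)
    qed
    then show ?case
      using G(1) y by (intro conjI exI[of _ "insert f G"])
        (auto simp: x A_add A_scale Lam_in_reduced)
  qed
  then show ?thesis ..
qed

lemma norm_ket_le:
  assumes unitary: "E_star_unitary (left_inverse_hull :: ('a \<Rightarrow> 'a option) set)"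
    and indep: "independent_family (J :: 'a set set)"
    and y: "y \<in> reduced_inverse_cstar" and q: "pmap q \<noteq> Map.empty"
  shows "norm (y (ket q)) \<le> norm (\<phi> y)"
proof -
  have separate: "\<exists>s. \<forall>f\<in>G. s \<in> dom (pmap f) \<longleftrightarrow> ran (pmap q) \<subseteq> dom (pmap f)"
    if G: "finite G" for G
  proof -
    define Y where "Y = ran (pmap q)"
    have "Y = dom (pmap (q\<^sup>\<star>))" by (auto simp: Y_def ran_def dom_def pmap_adjoint_iff)
    then have Y: "Y \<in> J" by (simp add: dom_in_J pmap)
    \<comment> \<open>Only domains not containing Y must be avoided. Their traces on Y are proper
      subsets belonging to \<open>J\<close>, so independence keeps them from covering Y, and any
      uncovered point serves as s.\<close>
    define F where "F = (\<lambda>f. Y \<inter> dom (pmap f)) ` {f \<in> G. \<not> Y \<subseteq> dom (pmap f)}"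
    have F: "finite F" "F \<subseteq> J"
      using G by (auto simp: F_def intro: J_Int[OF Y] dom_in_J pmap)
    \<comment> \<open>Settles the case of empty \<open>F\<close>, about which independence says
      nothing.\<close>
    have "Y \<noteq> {}" using q by (auto simp: Y_def ran_def fun_eq_iff)
    have "\<Union>F \<noteq> Y"
    proof
      assume "\<Union>F = Y"
      then have "\<exists>X\<in>F. X = Y"
        using indep F Y \<open>Y \<noteq> {}\<close> unfolding independent_family_def by blast
      then show False by (auto simp: F_def)
    qed
    moreover have "\<Union>F \<subseteq> Y" by (auto simp: F_def)
    ultimately obtain s where "s \<in> Y" "s \<notin> \<Union>F" by blast
    then show ?thesis by (intro exI[of _ s]) (auto simp: F_def Y_def)
  qed
  have diag: "cmod (coeff (z (ket q)) q) \<le> norm (\<phi> z)" if z: "z \<in> reduced_inverse_cstar" for z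
  proof -
    have span: "cmod (coeff (z (ket q)) q) \<le> norm (\<phi> z)"
      if z: "z \<in> complex_op.span (range Lam)" for z
    proof -
      obtain s where "coeff (z (ket q)) q = coeff (\<phi> z (ket s)) s"
        using diagonal_eq[OF unitary z] separate q by metis
      then have "cmod (coeff (z (ket q)) q) \<le> norm (\<phi> z (ket s))"
        by (simp add: coeff_le_norm)
      also have "\<dots> \<le> norm (\<phi> z)"
        using norm_blinfun[of "\<phi> z" "ket s"] by (simp add: norm_ket)
      finally show ?thesis .
    qed
    obtain X where X: "\<And>n. X n \<in> complex_op.span (range Lam)" "X \<longlonglongrightarrow> z"
      using z unfolding reduced_inverse_cstar_def closure_sequential by metis
    have "(\<lambda>n. cmod (coeff (X n (ket q)) q)) \<longlonglongrightarrow> cmod (coeff (z (ket q)) q)"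
      by (intro tendsto_norm tendsto_coeff blinfun.tendsto X tendsto_const)
    moreover have "(\<lambda>n. norm (\<phi> (X n))) \<longlonglongrightarrow> norm (\<phi> z)"
      by (intro tendsto_norm tendsto X z span_in_reduced)
    ultimately show ?thesis
      by (rule LIMSEQ_le) (use span X in blast)
  qed
  have "(norm (y (ket q)))\<^sup>2 = Re (cnj (coeff ((adj y o\<^sub>L y) (ket q)) q))"
    unfolding norm_apply_square[OF A_bounded[OF y]] inner_ell2_def cinner_ket_left ..
  also have "\<dots> \<le> norm (\<phi> (adj y o\<^sub>L y))"
    using complex_Re_le_cmod[of "cnj (coeff ((adj y o\<^sub>L y) (ket q)) q)"]
      diag[of "adj y o\<^sub>L y"] y by (simp add: A_compose A_adj)
  also have "\<dots> \<le> (norm (\<phi> y))\<^sup>2"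
    using norm_blinfun_compose[of "adj (\<phi> y)" "\<phi> y"] y
    by (simp add: compose adj A_adj norm_adj range_bounded power2_eq_square)
  finally show ?thesis by (rule power2_le_imp_le) simp
qed

end

section \<open>Quotients by star ideals\<close>

text \<open>Treats both shapes of \<open>zero_ideal\<close> at once. Matching
  \<open>star_hom\<close>, the quotient is purely algebraic and carries no norm.\<close>

locale star_ideal =
  fixes A N :: "'x op set"
  assumes subalgebra: "cstar_subalgebra A"
    and ideal_subset: "N \<subseteq> A"
    and ideal_zero: "0 \<in> N"
    and ideal_add: "S \<in> N \<Longrightarrow> T \<in> N \<Longrightarrow> S + T \<in> N"
    and ideal_scale: "T \<in> N \<Longrightarrow> op_scale c T \<in> N"
    and ideal_left: "S \<in> A \<Longrightarrow> T \<in> N \<Longrightarrow> S o\<^sub>L T \<in> N"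
    and ideal_right: "S \<in> N \<Longrightarrow> T \<in> A \<Longrightarrow> S o\<^sub>L T \<in> N"
    and ideal_adj: "T \<in> N \<Longrightarrow> adj T \<in> N"
begin

definition coset :: "'x op \<Rightarrow> 'x op set" where
  "coset a = N +>\<^bsub>op_algebra A\<^esub> a"

definition quotient :: "'x op set star_algebra" where
  "quotient = quotient_algebra (op_algebra A) N"

lemma coset_image: "coset a = (\<lambda>z. z + a) ` N"
  by (auto simp: coset_def a_r_coset_def' op_algebra_def)

lemma ideal_minus: "T \<in> N \<Longrightarrow> - T \<in> N"
  using ideal_scale[of T "-1"] by (simp add: op_scale_minus_one)

lemma coset_eq_iff: "coset a = coset b \<longleftrightarrow> a - b \<in> N"
proof
  assume "coset a = coset b"
  moreover have "a \<in> coset a" unfolding coset_image using ideal_zero by force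
  ultimately obtain z where "z \<in> N" "a = z + b" unfolding coset_image by blast
  then show "a - b \<in> N" by simp
next
  have sub: "coset a \<subseteq> coset b" if ab: "a - b \<in> N" for a b
  proof
    fix x assume "x \<in> coset a"
    then obtain z where z: "z \<in> N" "x = z + a" unfolding coset_image by blast
    then have "x = (z + (a - b)) + b" by simp
    then show "x \<in> coset b"
      unfolding coset_image using ideal_add[OF z(1) ab] by blast
  qed
  assume "a - b \<in> N"
  then show "coset a = coset b"
    using sub[of a b] sub[of b a] ideal_minus[of "a - b"] by auto
qed

text \<open>Operations of \<open>quotient_algebra\<close> are unions over representatives. When the
  result does not depend on the representative modulo \<open>N\<close>, all members of the union are
  the same coset.\<close>

lemma coset_cong_UN:
  assumes "\<And>z. z \<in> N \<Longrightarrow> f (z + a) - b \<in> N"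
  shows "(\<Union>x\<in>coset a. coset (f x)) = coset b"
proof -
  have "coset (f x) = coset b" if "x \<in> coset a" for x
    using that assms by (auto simp: coset_eq_iff coset_image[of a])
  moreover have "coset a \<noteq> {}" using ideal_zero by (auto simp: coset_image)
  ultimately show ?thesis by simp
qed

lemma carrier_quotient: "carrier quotient = coset ` A"
  by (auto simp: quotient_def quotient_algebra_def FactRing_def A_RCOSETS_def' coset_def[abs_def])
    (auto simp: op_algebra_def)

lemma add_quotient: "coset a \<oplus>\<^bsub>quotient\<^esub> coset b = coset (a + b)"
proof -
  have "coset a \<oplus>\<^bsub>quotient\<^esub> coset b = (\<Union>x\<in>coset a. \<Union>y\<in>coset b. {x + y})"
    by (simp add: quotient_def quotient_algebra_def FactRing_def set_add_def' op_algebra_def)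
  also have "\<dots> = coset (a + b)"
  proof (intro equalityI subsetI)
    fix x assume "x \<in> (\<Union>x\<in>coset a. \<Union>y\<in>coset b. {x + y})"
    then obtain z w where "z \<in> N" "w \<in> N" "x = (z + a) + (w + b)"
      by (auto simp: coset_image)
    moreover from this have "x = (z + w) + (a + b)" by (simp add: algebra_simps)
    ultimately show "x \<in> coset (a + b)"
      unfolding coset_image using ideal_add by blast
  next
    fix x assume "x \<in> coset (a + b)"
    then obtain z where "z \<in> N" "x = z + (a + b)" unfolding coset_image by blast
    then have "x = (z + a) + (0 + b)" by (simp add: algebra_simps)
    with \<open>z \<in> N\<close> ideal_zero show "x \<in> (\<Union>x\<in>coset a. \<Union>y\<in>coset b. {x + y})"
      unfolding coset_image by blast
  qed
  finally show ?thesis .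
qed

lemma mult_quotient:
  assumes ab: "a \<in> A" "b \<in> A"
  shows "coset a \<otimes>\<^bsub>quotient\<^esub> coset b = coset (a o\<^sub>L b)"
proof -
  have "coset a \<otimes>\<^bsub>quotient\<^esub> coset b = (\<Union>x\<in>coset a. \<Union>y\<in>coset b. coset (x o\<^sub>L y))"
    by (simp add: quotient_def quotient_algebra_def FactRing_def rcoset_mult_def coset_def)
      (simp add: op_algebra_def)
  \<comment> \<open>The inner union collapses by the left ideal property, for which x must lie in
    \<open>A\<close>; the outer one collapses by the right ideal property.\<close>
  also have "\<dots> = (\<Union>x\<in>coset a. coset (x o\<^sub>L b))"
  proof (intro SUP_cong refl coset_cong_UN)
    fix x z assume "x \<in> coset a" "z \<in> N"
    then have "x \<in> A"
      using subalgebra ab ideal_subset by (auto simp: coset_image cstar_subalgebra_def)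
    then show "(x o\<^sub>L (z + b)) - (x o\<^sub>L b) \<in> N"
      using ideal_left \<open>z \<in> N\<close> by (simp add: compose_add_right)
  qed
  also have "\<dots> = coset (a o\<^sub>L b)"
    by (rule coset_cong_UN) (simp add: compose_add_left ideal_right ab)
  finally show ?thesis .
qed

lemma scale_quotient: "c \<odot>\<^bsub>quotient\<^esub> coset a = coset (op_scale c a)"
proof -
  have "c \<odot>\<^bsub>quotient\<^esub> coset a = (\<Union>x\<in>coset a. coset (op_scale c x))"
    by (simp add: quotient_def quotient_algebra_def coset_def) (simp add: op_algebra_def)
  also have "\<dots> = coset (op_scale c a)"
    by (rule coset_cong_UN) (simp add: complex_op.scale_right_distrib ideal_scale)
  finally show ?thesis .
qed

lemma star_quotient:
  assumes a: "a \<in> A"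
  shows "star quotient (coset a) = coset (adj a)"
proof -
  have "star quotient (coset a) = (\<Union>x\<in>coset a. coset (adj x))"
    by (simp add: quotient_def quotient_algebra_def coset_def) (simp add: op_algebra_def)
  also have "\<dots> = coset (adj a)"
  proof (rule coset_cong_UN)
    fix z assume "z \<in> N"
    moreover from this have "z \<in> bounded_ops" "a \<in> bounded_ops"
      using a ideal_subset subalgebra by (auto simp: cstar_subalgebra_def)
    ultimately show "adj (z + a) - adj a \<in> N" by (simp add: adj_add ideal_adj)
  qed
  finally show ?thesis .
qed

lemma star_rep_of_star_hom:
  assumes h: "star_hom quotient (op_algebra B) h" and B: "B \<subseteq> bounded_ops"
  shows "star_rep A (\<lambda>a. h (coset a))"
proof
  have h_closed: "h (coset a) \<in> B" if "a \<in> A" for a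
    using h that unfolding star_hom_def by (auto simp: carrier_quotient op_algebra_def)
  show "cstar_subalgebra A" by (rule subalgebra)
  fix S T :: "'x op" and c :: complex
  assume T: "T \<in> A"
  show "h (coset T) \<in> bounded_ops" using h_closed[OF T] B by blast
  show "h (coset (op_scale c T)) = op_scale c (h (coset T))"
    using h T unfolding star_hom_def
    by (simp add: carrier_quotient scale_quotient[symmetric]) (simp add: op_algebra_def)
  show "h (coset (adj T)) = adj (h (coset T))"
    using h T unfolding star_hom_def
    by (simp add: carrier_quotient star_quotient[symmetric]) (simp add: op_algebra_def)
  assume S: "S \<in> A"
  show "h (coset (S + T)) = h (coset S) + h (coset T)"
    using h S T unfolding star_hom_def
    by (simp add: carrier_quotient add_quotient[symmetric]) (simp add: op_algebra_def)
  show "h (coset (S o\<^sub>L T)) = h (coset S) o\<^sub>L h (coset T)"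
    using h S T unfolding star_hom_def
    by (simp add: carrier_quotient mult_quotient[symmetric]) (simp add: op_algebra_def)
qed

end

section \<open>The ideal generated by the zero of the hull\<close>

context
  fixes Z :: "'a::left_cancel_monoid Il"
  assumes Z: "pmap Z = Map.empty"
begin

text \<open>\<open>Lam Z\<close> is the rank one projection onto \<open>ket Z\<close>: only the
  empty map has its range inside the empty set.\<close>

lemma Lam_zero_ket: "Lam Z (ket q) = (if q = Z then ket Z else 0)"
proof -
  have "ran (pmap q) \<subseteq> {} \<longleftrightarrow> q = Z"
    unfolding pmap_inject[symmetric] Z by (auto simp: ran_def fun_eq_iff) (metis not_None_eq)
  moreover have "Z * Z = Z"
    unfolding pmap_inject[symmetric] pmap_times by (simp add: Z)
  ultimately show ?thesis by (auto simp: Lam_ket_Il Z)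
qed

lemma adj_Lam_zero: "adj (Lam Z) = Lam Z"
proof -
  have "pmap (Z\<^sup>\<star>) = pmap Z"
    by (rule map_eqI) (simp add: pmap_adjoint_iff Z)
  then show ?thesis by (simp add: adj_Lam pmap_inject)
qed

text \<open>Each \<open>Lam p\<close> fixes \<open>ket Z\<close> because \<open>p * Z = Z\<close>.
  The line through \<open>ket Z\<close> is thus invariant under the span, and vanishing of the other
  coefficients is a closed condition.\<close>

lemma reduced_ket_zero:
  assumes "a \<in> reduced_inverse_cstar"
  obtains c where "a (ket Z) = c *\<^sub>C ket Z"
proof -
  have "reduced_inverse_cstar \<subseteq> {a :: 'a Il op. \<forall>y. y \<noteq> Z \<longrightarrow> coeff (a (ket Z)) y = 0}"
    unfolding reduced_inverse_cstar_def
  proof (rule closure_minimal)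
    show "complex_op.span (range Lam) \<subseteq> {a :: 'a Il op. \<forall>y. y \<noteq> Z \<longrightarrow> coeff (a (ket Z)) y = 0}"
    proof
      fix a :: "'a Il op" assume "a \<in> complex_op.span (range Lam)"
      then show "a \<in> {a :: 'a Il op. \<forall>y. y \<noteq> Z \<longrightarrow> coeff (a (ket Z)) y = 0}"
      proof (induction rule: complex_op.span_induct_alt)
        case (step c x a)
        then obtain p where p: "x = Lam p" by blast
        have "p * Z = Z"
          unfolding pmap_inject[symmetric] pmap_times by (simp add: Z)
        then have "Lam p (ket Z) = ket Z" by (simp add: Lam_ket_Il Z)
        with step p show ?case
          by (simp add: blinfun.add_left op_scale_apply coeff_simps)
      qed (simp add: coeff_simps)
    qed
    have "closed {a :: 'a Il op. y \<noteq> Z \<longrightarrow> coeff (a (ket Z)) y = 0}" for y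
      by (cases "y = Z")
        (auto intro!: closed_Collect_eq continuous_intros
          bounded_linear.continuous_on[OF bounded_linear_coeff])
    then show "closed {a :: 'a Il op. \<forall>y. y \<noteq> Z \<longrightarrow> coeff (a (ket Z)) y = 0}"
      by (rule closed_Collect_all)
  qed
  with assms have "coeff (a (ket Z)) y = 0" if "y \<noteq> Z" for y
    using that by blast
  then have "a (ket Z) = coeff (a (ket Z)) Z *\<^sub>C ket Z"
    by (simp add: coeff_inject[symmetric] coeff_simps fun_eq_iff)
  then show thesis by (rule that)
qed

lemma compose_Lam_zero:
  assumes "a \<in> reduced_inverse_cstar"
  obtains c where "a o\<^sub>L Lam Z = op_scale c (Lam Z)"
proof -
  obtain c where c: "a (ket Z) = c *\<^sub>C ket Z"
    using reduced_ket_zero[OF assms] .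
  have a: "a \<in> bounded_ops"
    using assms cstar_subalgebra_reduced by (auto simp: cstar_subalgebra_def)
  have "a o\<^sub>L Lam Z = op_scale c (Lam Z)"
  proof (rule bounded_ops_eqI)
    have "c *\<^sub>C 0 = (0 :: 'a Il ell2)" by transfer simp
    then show "(a o\<^sub>L Lam Z) (ket q) = op_scale c (Lam Z) (ket q)" for q
      by (simp add: Lam_zero_ket op_scale_apply c blinfun.zero_right)
  qed (simp_all add: bounded_ops_closed_operations Lam_bounded a)
  then show thesis by (rule that)
qed

end

lemma star_ideal_zero_ideal: "star_ideal reduced_inverse_cstar (zero_ideal :: 'a::left_cancel_monoid Il op set)"
proof -
  note A = cstar_subalgebra_reduced[where 'a = 'a, unfolded cstar_subalgebra_def]
  show ?thesis
  proof (cases "Map.empty \<in> (left_inverse_hull :: ('a \<Rightarrow> 'a option) set)")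
    case False
    then have N: "zero_ideal = {0 :: 'a Il op}" by (simp add: zero_ideal_def)
    show ?thesis
      using A by unfold_locales
        (simp_all add: N cstar_subalgebra_reduced adj_zero compose_zero_left compose_zero_right)
  next
    case True
    define Z :: "'a Il" where "Z = Abs_Il Map.empty"
    have Z: "pmap Z = Map.empty" unfolding Z_def by (rule Abs_Il_inverse[OF True])
    have N: "zero_ideal = range (\<lambda>c. op_scale c (Lam Z))"
      using True by (auto simp: zero_ideal_def Z_def)
    have left: "S o\<^sub>L op_scale c (Lam Z) \<in> zero_ideal" if S: "S \<in> reduced_inverse_cstar" for S c
    proof -
      obtain d where "S o\<^sub>L Lam Z = op_scale d (Lam Z)" using compose_Lam_zero[OF Z S] .
      moreover have "S \<in> bounded_ops" using S A by blast
      ultimately show ?thesis by (auto simp: N compose_op_scale_right)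
    qed
    have adj: "adj T \<in> zero_ideal" if "T \<in> zero_ideal" for T :: "'a Il op"
      using that by (auto simp: N adj_scale Lam_bounded adj_Lam_zero[OF Z])
    show ?thesis
    proof
      show "cstar_subalgebra (reduced_inverse_cstar :: 'a Il op set)"
        by (rule cstar_subalgebra_reduced)
      show sub: "zero_ideal \<subseteq> (reduced_inverse_cstar :: 'a Il op set)"
        using A Lam_in_reduced[of Z] by (auto simp: N)
      show "0 \<in> (zero_ideal :: 'a Il op set)"
        using complex_op.scale_zero_left[of "Lam Z"] unfolding N by (metis rangeI)
      show "S + T \<in> zero_ideal" if "S \<in> zero_ideal" "T \<in> zero_ideal" for S T :: "'a Il op"
        using that by (auto simp: N complex_op.scale_left_distrib[symmetric])
      show "op_scale c T \<in> zero_ideal" if "T \<in> zero_ideal" for c and T :: "'a Il op"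
        using that by (auto simp: N)
      show "S o\<^sub>L T \<in> zero_ideal" if "S \<in> reduced_inverse_cstar" "T \<in> zero_ideal" for S T :: "'a Il op"
        using that left by (auto simp: N)
      show "adj T \<in> zero_ideal" if "T \<in> zero_ideal" for T :: "'a Il op" using that by (rule adj)
      show "S o\<^sub>L T \<in> zero_ideal" if S: "S \<in> zero_ideal" and T: "T \<in> reduced_inverse_cstar"
        for S T :: "'a Il op"
      proof -
        obtain c where c: "S = op_scale c (Lam Z)" using S by (auto simp: N)
        have b: "S \<in> bounded_ops" "T \<in> bounded_ops" using S T sub A by blast+
        \<comment> \<open>The right ideal property is the adjoint of the left one.\<close>
        have "adj T o\<^sub>L adj S \<in> zero_ideal"
          using T A left[of "adj T" "cnj c"]
          by (simp add: c adj_scale Lam_bounded adj_Lam_zero[OF Z])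
        then have "adj (adj T o\<^sub>L adj S) \<in> zero_ideal" by (rule adj)
        then show ?thesis
          using b by (simp add: adj_compose adj_in_bounded_ops adj_adj)
      qed
    qed
  qed
qed

lemma zero_ideal_ket:
  assumes "z \<in> zero_ideal" "pmap q \<noteq> Map.empty"
  shows "z (ket q) = 0"
proof (cases "Map.empty \<in> (left_inverse_hull :: ('a::left_cancel_monoid \<Rightarrow> 'a option) set)")
  case True
  then have "pmap (Abs_Il Map.empty :: 'a Il) = Map.empty" by (rule Abs_Il_inverse)
  moreover have "c *\<^sub>C 0 = (0 :: 'a Il ell2)" for c by transfer simp
  ultimately show ?thesis
    using True assms by (auto simp: zero_ideal_def op_scale_apply Lam_zero_ket)
qed (use assms in \<open>simp add: zero_ideal_def\<close>)

text \<open>If the hull has a zero, subtract the scalar by which \<open>a\<close> acts on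
  \<open>ket Z\<close>; otherwise the condition on \<open>q\<close> is vacuous and \<open>0\<close>
  serves.\<close>

lemma reduce_mod_zero_ideal:
  assumes a: "a \<in> reduced_inverse_cstar"
  obtains z where "z \<in> zero_ideal" "\<And>q :: 'a::left_cancel_monoid Il. pmap q = Map.empty \<Longrightarrow> (a - z) (ket q) = 0"
proof (cases "Map.empty \<in> (left_inverse_hull :: ('a \<Rightarrow> 'a option) set)")
  case False
  then have "pmap q \<noteq> Map.empty" for q :: "'a Il" using pmap[of q] by metis
  moreover have "0 \<in> (zero_ideal :: 'a Il op set)" using False by (simp add: zero_ideal_def)
  ultimately show thesis using that by blast
next
  case True
  define Z :: "'a Il" where "Z = Abs_Il Map.empty"
  have Z: "pmap Z = Map.empty" unfolding Z_def by (rule Abs_Il_inverse[OF True])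
  obtain c where c: "a (ket Z) = c *\<^sub>C ket Z" using reduced_ket_zero[OF Z a] .
  show thesis
  proof (rule that)
    show "op_scale c (Lam Z) \<in> zero_ideal" using True by (auto simp: zero_ideal_def Z_def)
    show "(a - op_scale c (Lam Z)) (ket q) = 0" if "pmap q = Map.empty" for q
    proof -
      have "q = Z" using that Z by (metis pmap_inject)
      then show ?thesis by (simp add: blinfun.diff_left op_scale_apply Lam_zero_ket[OF Z] c)
    qed
  qed
qed

section \<open>Injectivity and independence\<close>

context hull_rep
begin

lemma injective_onto_if_independent:
  assumes unitary: "E_star_unitary (left_inverse_hull :: ('a \<Rightarrow> 'a option) set)"
    and indep: "independent_family (J :: 'a set set)"
    and kernel: "\<And>z. z \<in> zero_ideal \<Longrightarrow> \<phi> z = 0"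
  shows "a \<in> reduced_inverse_cstar \<Longrightarrow> \<phi> a = 0 \<Longrightarrow> a \<in> zero_ideal"
    and "cstar_subalgebra (\<phi> ` reduced_inverse_cstar)"
proof -
  \<comment> \<open>Representatives vanishing at the empty map. Every coset contains one, and for
    these the bounds at the remaining basis vectors are enough for
    \<open>norm_le_norm_image\<close>.\<close>
  define B where
    "B = {a \<in> reduced_inverse_cstar. \<forall>q :: 'a Il. pmap q = Map.empty \<longrightarrow> a (ket q) = 0}"
  have bound: "norm b \<le> norm (\<phi> b)" if "b \<in> B" for b
  proof (rule norm_le_norm_image[where K = "{q. pmap q \<noteq> Map.empty}"])
    show "norm (S (ket q)) \<le> norm (\<phi> S)"
      if "S \<in> reduced_inverse_cstar" "q \<in> {q. pmap q \<noteq> Map.empty}" for S q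
      using norm_ket_le[OF unitary indep that(1)] that(2) by simp
    show "b \<in> reduced_inverse_cstar" using that by (simp add: B_def)
    show "b (ket q) = 0" if "q \<notin> {q. pmap q \<noteq> Map.empty}" for q
      using that \<open>b \<in> B\<close> by (simp add: B_def)
  qed
  have reduce: "\<exists>z\<in>zero_ideal. a - z \<in> B \<and> \<phi> (a - z) = \<phi> a"
    if a: "a \<in> reduced_inverse_cstar" for a
  proof -
    obtain z where z: "z \<in> zero_ideal" "\<And>q :: 'a Il. pmap q = Map.empty \<Longrightarrow> (a - z) (ket q) = 0"
      using reduce_mod_zero_ideal[OF a] by blast
    have zA: "z \<in> reduced_inverse_cstar"
      using z(1) star_ideal.ideal_subset[OF star_ideal_zero_ideal] by blast
    show ?thesis
      using z A_diff[OF a zA] diff[OF a zA] kernel[OF z(1)] by (intro bexI[of _ z]) (simp_all add: B_def)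
  qed
  show "a \<in> zero_ideal" if a: "a \<in> reduced_inverse_cstar" "\<phi> a = 0"
  proof -
    obtain z where z: "z \<in> zero_ideal" "a - z \<in> B" "\<phi> (a - z) = \<phi> a"
      using reduce[OF a(1)] by blast
    then have "norm (a - z) \<le> 0" using bound[OF z(2)] a(2) by simp
    then show ?thesis using z(1) by simp
  qed
  show "cstar_subalgebra (\<phi> ` reduced_inverse_cstar)"
  proof (rule cstar_subalgebra_image)
    show "B \<subseteq> reduced_inverse_cstar" by (auto simp: B_def)
    show "a - b \<in> B" if "a \<in> B" "b \<in> B" for a b
      using that by (auto simp: B_def A_diff blinfun.diff_left)
    show "\<exists>b\<in>B. \<phi> b = \<phi> a" if "a \<in> reduced_inverse_cstar" for a
      using reduce[OF that] by blast
  qed (rule bound)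
qed

text \<open>
  The operator is the product of \<open>Lam e\<^sub>Y\<close> with the factors \<open>1 - Lam e\<^sub>X\<close>, where \<open>e\<^sub>X\<close> is
  the partial identity on \<open>X\<close>.
\<close>

lemma covering_operator:
  assumes Y: "Y \<in> J" and F: "finite F" "F \<subseteq> J" "\<And>X. X \<in> F \<Longrightarrow> \<not> Y \<subseteq> X"
  shows "\<exists>a\<in>reduced_inverse_cstar.
    blinfun_apply a (ket (Abs_Il (partial_id Y))) = ket (Abs_Il (partial_id Y)) \<and>
    (\<forall>s. \<phi> a (ket s) = (if s \<in> Y - \<Union>F then ket s else 0))"
proof -
  define e :: "'a set \<Rightarrow> 'a Il" where "e X = Abs_Il (partial_id X)" for X
  have e: "pmap (e X) = partial_id X" if "X \<in> J" for X
    using that by (simp add: e_def pmap_Abs_partial_id)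
  have omega_e: "omega (e X) (ket s) = (if s \<in> X then ket s else 0)" if "X \<in> J" for X s
    using that by (simp add: omega_ket e partial_id_def)
  have "\<exists>a\<in>reduced_inverse_cstar. blinfun_apply a (ket (e Y)) = ket (e Y) \<and>
    (\<forall>s. \<phi> a (ket s) = (if s \<in> Y - \<Union>F then ket s else 0))"
    using F
  proof (induction F rule: finite_induct)
    case empty
    have "e Y * e Y = e Y"
      unfolding pmap_inject[symmetric] pmap_times e[OF Y] by (simp flip: partial_id_Int)
    then have "Lam (e Y) (ket (e Y)) = ket (e Y)"
      by (simp add: Lam_ket_Il e[OF Y] dom_partial_id ran_partial_id)
    then show ?case
      by (intro bexI[OF _ Lam_in_reduced[of "e Y"]]) (simp add: Lam omega_e[OF Y])
  next
    case (insert X F)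
    then obtain a :: "'a Il op" where a: "a \<in> reduced_inverse_cstar" "a (ket (e Y)) = ket (e Y)"
      "\<And>s. \<phi> a (ket s) = (if s \<in> Y - \<Union>F then ket s else 0)"
      by auto
    have X: "X \<in> J" "\<not> Y \<subseteq> X" using insert.prems by auto
    \<comment> \<open>Here \<open>Lam\<close> and \<open>omega\<close> part ways:
      \<open>Lam (e X)\<close> tests inclusion of the whole of Y in X and so kills
      \<open>ket (e Y)\<close>, whereas \<open>omega (e X)\<close> tests single points.\<close>
    let ?b = "a - (a o\<^sub>L Lam (e X))"
    have "?b \<in> reduced_inverse_cstar"
      using a(1) by (intro A_diff A_compose Lam_in_reduced)
    moreover have "?b (ket (e Y)) = ket (e Y)"
      using X by (simp add: blinfun.diff_left blinfun.zero_right a(2) Lam_ket_Il e[OF X(1)] e[OF Y]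
          dom_partial_id ran_partial_id)
    moreover have "\<phi> ?b (ket s) = (if s \<in> Y - \<Union>(insert X F) then ket s else 0)" for s
      using a(1)
      by (simp add: diff compose A_compose Lam_in_reduced Lam omega_e[OF X(1)] a(3)
          blinfun.diff_left blinfun.zero_right)
    ultimately show ?case by blast
  qed
  then show ?thesis by (simp add: e_def)
qed

lemma independent_if_injective:
  assumes inj: "\<And>a. a \<in> reduced_inverse_cstar \<Longrightarrow> \<phi> a = 0 \<Longrightarrow> a \<in> zero_ideal"
  shows "independent_family (J :: 'a set set)"
  unfolding independent_family_def
proof (intro allI impI, elim conjE)
  fix F and Y :: "'a set"
  assume F: "finite F" "F \<noteq> {}" "F \<subseteq> J" and Y: "Y \<in> J" "\<Union>F = Y"
  show "\<exists>X\<in>F. X = Y"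
  proof (rule ccontr)
    assume neg: "\<not> (\<exists>X\<in>F. X = Y)"
    then have sub: "\<not> Y \<subseteq> X" if "X \<in> F" for X using that Y(2) by blast
    \<comment> \<open>An empty Y would be contained in every member of \<open>F\<close>. Hence
      \<open>?e\<close> is not the empty map, on whose basis vector elements of
      \<open>zero_ideal\<close> need not vanish.\<close>
    then have "Y \<noteq> {}" using F(2) by blast
    let ?e = "Abs_Il (partial_id Y) :: 'a Il"
    obtain a :: "'a Il op" where a: "a \<in> reduced_inverse_cstar" "a (ket ?e) = ket ?e"
      "\<And>s. \<phi> a (ket s) = (if s \<in> Y - \<Union>F then ket s else 0)"
      using covering_operator[OF Y(1) F(1,3) sub] by blast
    have "\<phi> a = 0"
      by (rule bounded_ops_eqI)
        (simp_all add: range_bounded a(1) a(3) bounded_ops_closed_operations Y(2))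
    then have "a \<in> zero_ideal" by (rule inj[OF a(1)])
    moreover have "pmap ?e \<noteq> Map.empty"
      using \<open>Y \<noteq> {}\<close> dom_partial_id[of Y] by (auto simp: pmap_Abs_partial_id[OF Y(1)])
    ultimately have "a (ket ?e) = 0" by (rule zero_ideal_ket)
    with a(2) show False using ket_neq_zero by metis
  qed
qed

end

section \<open>The canonical homomorphism\<close>

lemma V_eq_omega: "V s = omega (Abs_Il (left_mult s))"
  by (simp add: V_def omega_def Abs_Il_inverse left_mult_hull)

theorem theorem3p2p14:
  fixes h :: "'a::left_cancel_monoid Il op set \<Rightarrow> 'a op"
  assumes "E_star_unitary (left_inverse_hull :: ('a \<Rightarrow> 'a option) set)"
    and "star_hom Cstar_r0_Il Cstar_r h"
    and "\<And>f. h (Lam0 f) = omega f"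
  shows "star_iso Cstar_r0_Il Cstar_r h \<longleftrightarrow> independent_family (J :: 'a set set)"
proof -
  let ?A = "reduced_inverse_cstar :: 'a Il op set"
  let ?B = "cstar_generated (range V) :: 'a op set"
  interpret star_ideal ?A zero_ideal by (rule star_ideal_zero_ideal)
  define \<phi> where "\<phi> = (\<lambda>a. h (coset a))"
  have Cr0: "Cstar_r0_Il = quotient" by (simp add: Cstar_r0_Il_def quotient_def)
  have "?B \<subseteq> bounded_ops"
    by (rule cstar_generated_bounded) (auto simp: V_eq_omega omega_bounded)
  then have "star_rep ?A \<phi>"
    using assms(2) unfolding \<phi>_def Cr0 Cstar_r_def by (intro star_rep_of_star_hom)
  moreover have \<phi>_Lam: "\<phi> (Lam f) = omega f" for f
    using assms(3)[of f] by (simp add: \<phi>_def Lam0_def coset_def)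
  ultimately interpret hull_rep \<phi>
    by (intro hull_rep.intro hull_rep_axioms.intro)
  have kernel: "\<phi> z = 0" if "z \<in> zero_ideal" for z
    using that coset_eq_iff[of z 0] zero by (simp add: \<phi>_def)
  have \<phi>_B: "\<phi> ` ?A \<subseteq> ?B"
    using assms(2) by (auto simp: star_hom_def Cr0 carrier_quotient Cstar_r_def op_algebra_def \<phi>_def)
  have iso_iff: "star_iso Cstar_r0_Il Cstar_r h \<longleftrightarrow> inj_on h (coset ` ?A) \<and> \<phi> ` ?A = ?B"
    using assms(2)
    by (simp add: star_iso_def bij_betw_def Cr0 carrier_quotient Cstar_r_def image_image \<phi>_def)
      (simp add: op_algebra_def)
  have inj_iff: "inj_on h (coset ` ?A) \<longleftrightarrow> (\<forall>a\<in>?A. \<phi> a = 0 \<longrightarrow> a \<in> zero_ideal)"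
  proof
    assume inj: "inj_on h (coset ` ?A)"
    show "\<forall>a\<in>?A. \<phi> a = 0 \<longrightarrow> a \<in> zero_ideal"
    proof (intro ballI impI)
      fix a assume a: "a \<in> ?A" "\<phi> a = 0"
      then have "h (coset a) = h (coset 0)" using zero by (simp add: \<phi>_def)
      then have "coset a = coset 0" using a A_zero by (intro inj_onD[OF inj]) auto
      then show "a \<in> zero_ideal" by (simp add: coset_eq_iff)
    qed
  next
    assume *: "\<forall>a\<in>?A. \<phi> a = 0 \<longrightarrow> a \<in> zero_ideal"
    show "inj_on h (coset ` ?A)"
    proof (rule inj_onI, elim imageE)
      fix x y a b assume xy: "h x = h y" "x = coset a" "y = coset b" "a \<in> ?A" "b \<in> ?A"
      then have "\<phi> (a - b) = 0" by (simp add: diff) (simp add: \<phi>_def)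
      then show "x = y" using xy * by (simp add: coset_eq_iff A_diff)
    qed
  qed
  show ?thesis
  proof
    assume "star_iso Cstar_r0_Il Cstar_r h"
    then show "independent_family (J :: 'a set set)"
      using independent_if_injective inj_iff iso_iff by blast
  next
    assume indep: "independent_family (J :: 'a set set)"
    note main = injective_onto_if_independent[OF assms(1) indep kernel]
    \<comment> \<open>\<open>V s\<close> is the value of \<open>\<phi>\<close> at \<open>Lam\<close>
      of left multiplication by s, so the image, a C*-subalgebra by \<open>main(2)\<close>, contains
      everything the \<open>V s\<close> generate.\<close>
    have "range V \<subseteq> \<phi> ` ?A"
      using Lam_in_reduced by (auto simp: V_eq_omega \<phi>_Lam[symmetric])
    then have "?B \<subseteq> \<phi> ` ?A"
      by (intro cstar_generated_minimal main(2))
    with \<phi>_B main(1) show "star_iso Cstar_r0_Il Cstar_r h"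
      using inj_iff iso_iff by blast
  qed
qed

end
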